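(* Let $p\in(1,2]$ and $K\ge1$, and define $$c(K,p)=\left(\frac{\tan^{p-1}\frac{\pi}{2p}}{\cot\frac{\pi}{2p}}+(K^2-1)\frac{\sin^{p-1}\frac{\pi}{2p}}{\cos\frac{\pi}{2p}}\right)^{1/p},\qquad d(K,p)=\left(\Bigl(\cos\frac{\pi}{2p}\Bigr)^{-p}+(K^2-1)\tan\frac{\pi}{2p}\right)^{1/p}.$$ Let $f$ be a $K$-quasiregular harmonic mapping of the unit disk $\mathbb{D}$ into $\mathbb{C}$ such that $\arg f(0)\in\left(-\frac{\pi}{2p},\frac{\pi}{2p}\right)$, $\operatorname{Re} f\in\mathbf{h}^p$, and $f(\mathbb{D})\cap(-\infty,0)=\emptyset$. Then $f\in\mathbf{h}^p$ and (a) $\|\operatorname{Im} f\|_p\le c(K,p)\,\|\operatorname{Re} f\|_p$; (b) $\|f\|_p\le d(K,p)\,\|\operatorname{Re} f\|_p$.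
   Context: A mapping $f:\mathbb{D}\to\mathbb{C}\cong\mathbb{R}^2$ is $K$-quasiregular ($K\ge1$) if it is continuous, nonconstant, belongs to $W^{1,2}_{loc}$, and $|Df(z)|\le K\,\ell(Df(z))$ for a.e. $z$, where $|Df|=\sup_{|h|=1}|Df\,h|$ and $\ell(Df)=\inf_{|h|=1}|Df\,h|$. A harmonic mapping is one with $\Delta f=0$, equivalently $f=g+\overline{h}$ with $g,h$ holomorphic in $\mathbb{D}$. For harmonic $f$ on $\mathbb{D}$, $\|f\|_p=\sup_{0<r<1}\left(\int_0^{2\pi}|f(re^{it})|^p\frac{dt}{2\pi}\right)^{1/p}$, and $f\in\mathbf{h}^p$ means $\|f\|_p<\infty$. Here $\arg$ denotes the principal argument with values in $(-\pi,\pi]$. *)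

theory Defs
  imports "HOL-Complex_Analysis.Complex_Analysis"
begin

definition harmonic_disk :: "(complex \<Rightarrow> complex) \<Rightarrow> bool" where
  "harmonic_disk f \<longleftrightarrow> (\<exists>g h. g holomorphic_on ball 0 1 \<and> h holomorphic_on ball 0 1 \<and>
      (\<forall>z\<in>ball 0 1. f z = g z + cnj (h z)))"

definition min_stretch :: "(complex \<Rightarrow> complex) \<Rightarrow> real" where
  "min_stretch L = Inf {norm (L h) | h. norm h = 1}"

definition quasiregular_disk :: "real \<Rightarrow> (complex \<Rightarrow> complex) \<Rightarrow> bool" where
  "quasiregular_disk K f \<longleftrightarrow> continuous_on (ball 0 1) f \<and>
     \<not> (\<exists>c. \<forall>z\<in>ball 0 1. f z = c) \<and>
     (AE z in lborel. z \<in> ball 0 1 \<longrightarrow>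
        f differentiable (at z) \<and>
        onorm (frechet_derivative f (at z)) \<le> K * min_stretch (frechet_derivative f (at z)))"

definition circ_mean :: "real \<Rightarrow> (complex \<Rightarrow> 'a::real_normed_vector) \<Rightarrow> real \<Rightarrow> real" where
  "circ_mean p u r = integral {0..2*pi} (\<lambda>t. norm (u (of_real r * exp (\<i> * of_real t))) powr p) / (2*pi)"

definition hp_norm :: "real \<Rightarrow> (complex \<Rightarrow> 'a::real_normed_vector) \<Rightarrow> real" where
  "hp_norm p u = (SUP r\<in>{0<..<1}. circ_mean p u r powr (1/p))"

definition in_hp :: "real \<Rightarrow> (complex \<Rightarrow> 'a::real_normed_vector) \<Rightarrow> bool" where
  "in_hp p u \<longleftrightarrow> bdd_above ((\<lambda>r. circ_mean p u r powr (1/p)) ` {0<..<1})"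

definition cKp :: "real \<Rightarrow> real \<Rightarrow> real" where
  "cKp K p = (tan (pi/(2*p)) powr (p-1) / cot (pi/(2*p))
              + (K^2 - 1) * sin (pi/(2*p)) powr (p-1) / cos (pi/(2*p))) powr (1/p)"

definition dKp :: "real \<Rightarrow> real \<Rightarrow> real" where
  "dKp K p = (cos (pi/(2*p)) powr (-p) + (K^2 - 1) * tan (pi/(2*p))) powr (1/p)"

end

theory Submission
  imports Defs
begin

text \<open>Put \<open>\<theta> = pi/(2p)\<close> and \<open>\<Phi>(w) = Re (w powr p)\<close>. By Pichorides-type inequalities, both
  \<open>\<bar>Im w\<bar> powr p\<close> and \<open>\<bar>w\<bar> powr p\<close> are at most \<open>\<alpha> \<bar>Re w\<bar> powr p - \<beta> \<Phi>(w)\<close> for suitable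
  \<open>\<alpha>, \<beta> \<ge> 0\<close> depending on \<open>\<theta>\<close>, so it suffices to bound the circle means of \<open>\<Phi>(f)\<close> from below.
  Write \<open>f = g + cnj h\<close>. The dilatation condition gives \<open>4 \<bar>g' h'\<bar> \<le> (K\<^sup>2 - 1) \<bar>g' + h'\<bar>\<^sup>2\<close>; the left-hand
  side controls the Laplacian of \<open>\<Phi>(f)\<close>, the right-hand side that of \<open>\<bar>Re f\<bar> powr p\<close>, and
  \<open>\<bar>f\<bar> powr (p-2) \<le> \<bar>Re f\<bar> powr (p-2)\<close> because \<open>p \<le> 2\<close>. Hence \<open>\<Phi>(f) + (K\<^sup>2 - 1) \<bar>Re f\<bar> powr p\<close> is
  subharmonic, and its circle means are at least \<open>\<Phi>(f(0)) \<ge> 0\<close>.\<close>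

section \<open>Pichorides-type inequalities\<close>

text \<open>The derivative of sin(qt)/sin t has a numerator that vanishes at t = 0 and itself has
  derivative (1 - q^2) sin t sin(qt) >= 0, so the quotient is nondecreasing on (0, pi/2].\<close>

lemma sin_mult_ratio_mono:
  fixes q x y :: real
  assumes q: "0 < q" "q \<le> 1" and x: "0 < x" "x \<le> y" "y \<le> pi/2"
  shows "sin (q*x) * sin y \<le> sin (q*y) * sin x"
proof -
  have wronskian: "0 \<le> q * cos (q*t) * sin t - sin (q*t) * cos t" if t: "0 < t" "t \<le> pi/2" for t
  proof -
    have "q * cos (q*0) * sin 0 - sin (q*0) * cos 0 \<le> q * cos (q*t) * sin t - sin (q*t) * cos t"
    proof (rule DERIV_nonneg_imp_nondecreasing[where f="\<lambda>t. q * cos (q*t) * sin t - sin (q*t) * cos t"])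
      fix s assume s: "0 \<le> s" "s \<le> t"
      have "q * s \<le> 1 * s" using q s by (intro mult_right_mono) auto
      then have "0 \<le> sin s * sin (q * s)"
        using s t q by (intro mult_nonneg_nonneg sin_ge_zero) auto
      moreover have "q^2 \<le> 1" using q by (simp add: power_le_one)
      ultimately have "0 \<le> (1 - q^2) * (sin s * sin (q * s))" by simp
      moreover have "((\<lambda>t. q * cos (q*t) * sin t - sin (q*t) * cos t) has_real_derivative
          (1 - q^2) * (sin s * sin (q * s))) (at s)"
        by (auto intro!: derivative_eq_intros simp: algebra_simps power2_eq_square)
      ultimately show "\<exists>d. ((\<lambda>t. q * cos (q*t) * sin t - sin (q*t) * cos t) has_real_derivative d) (at s) \<and> 0 \<le> d"
        by blast
    qed (use t in auto)
    then show ?thesis by simp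
  qed
  have pos: "0 < sin t" if "x \<le> t" "t \<le> y" for t
    using that x by (intro sin_gt_zero) (auto intro: less_le_trans)
  have "sin (q*x) / sin x \<le> sin (q*y) / sin y"
  proof (rule DERIV_nonneg_imp_nondecreasing[OF x(2)])
    fix t assume t: "x \<le> t" "t \<le> y"
    have "((\<lambda>t. sin (q*t) / sin t) has_real_derivative
        (q * cos (q*t) * sin t - sin (q*t) * cos t) / (sin t)^2) (at t)"
      using pos[OF t] by (auto intro!: derivative_eq_intros simp: power2_eq_square algebra_simps)
    moreover have "0 \<le> (q * cos (q*t) * sin t - sin (q*t) * cos t) / (sin t)^2"
      using wronskian[of t] t x by (intro divide_nonneg_nonneg) auto
    ultimately show "\<exists>d. ((\<lambda>t. sin (q*t) / sin t) has_real_derivative d) (at t) \<and> 0 \<le> d" by blast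
  qed
  then show ?thesis using pos[of x] pos[of y] x by (simp add: field_simps)
qed

text \<open>The function sin(qt) (sin t)^(-q) has derivative q (sin t)^(-q-1) sin((1-q)t), which is
  nonnegative because (1-q)t stays in [0, pi].\<close>

lemma sin_powr_ratio_mono:
  fixes q x y :: real
  assumes q: "0 < q" "q \<le> 1" and x: "0 < x" "x \<le> y" "y \<le> pi/2"
  shows "sin (q*x) * sin y powr q \<le> sin (q*y) * sin x powr q"
proof -
  have pos: "0 < sin t" if "x \<le> t" "t \<le> y" for t
    using that x by (intro sin_gt_zero) (auto intro: less_le_trans)
  have "sin (q*x) * sin x powr (-q) \<le> sin (q*y) * sin y powr (-q)"
  proof (rule DERIV_nonneg_imp_nondecreasing[OF x(2)])
    fix t assume t: "x \<le> t" "t \<le> y"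
    have e: "sin t powr (-q) = sin t powr (-q-1) * sin t"
      using pos[OF t] powr_mult_base[of "sin t" "-q-1"] by (simp add: mult.commute)
    have s: "sin ((1-q)*t) = sin t * cos (q*t) - cos t * sin (q*t)"
      by (simp add: left_diff_distrib sin_diff)
    have "((\<lambda>t. sin (q*t) * sin t powr (-q)) has_real_derivative
        q * sin t powr (-q-1) * sin ((1-q)*t)) (at t)"
      unfolding s using pos[OF t]
      by (auto intro!: derivative_eq_intros) (simp add: e algebra_simps)
    moreover have "0 \<le> sin ((1-q)*t)"
    proof (rule sin_ge_zero)
      show "0 \<le> (1-q)*t" using q t x by simp
      have "(1-q)*t \<le> 1*t" using q t x by (intro mult_right_mono) auto
      then show "(1-q)*t \<le> pi" using t x by linarith
    qed
    then have "0 \<le> q * sin t powr (-q-1) * sin ((1-q)*t)" using q by simp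
    ultimately show "\<exists>d. ((\<lambda>t. sin (q*t) * sin t powr (-q)) has_real_derivative d) (at t) \<and> 0 \<le> d" by blast
  qed
  then show ?thesis using pos[of x] pos[of y] x by (simp add: powr_minus field_simps)
qed

text \<open>Tailored to functions with a factor \<open>cos t powr (-p)\<close>, for which the end
  point \<open>b = pi/2\<close> has to be excluded. At \<open>a\<close> only continuity is asked,
  since the base of \<open>sin t powr p\<close> vanishes at 0.\<close>

lemma le_at_peak:
  fixes \<psi> \<psi>' :: "real \<Rightarrow> real"
  assumes cont: "continuous_on {a..<b} \<psi>" and c: "a < c" "c < b"
    and der: "\<And>t. a < t \<Longrightarrow> t < b \<Longrightarrow> (\<psi> has_real_derivative \<psi>' t) (at t)"
    and up: "\<And>t. a < t \<Longrightarrow> t \<le> c \<Longrightarrow> 0 \<le> \<psi>' t"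
    and down: "\<And>t. c \<le> t \<Longrightarrow> t < b \<Longrightarrow> \<psi>' t \<le> 0"
    and t: "a \<le> t" "t < b"
  shows "\<psi> t \<le> \<psi> c"
proof (cases "t \<le> c")
  case True
  show ?thesis
  proof (rule DERIV_nonneg_imp_increasing_open[OF True])
    show "\<exists>y. (\<psi> has_real_derivative y) (at x) \<and> 0 \<le> y" if "t < x" "x < c" for x
      using der[of x] up[of x] that t c by (intro exI[of _ "\<psi>' x"]) auto
    show "continuous_on {t..c} \<psi>" using t c by (intro continuous_on_subset[OF cont]) auto
  qed
next
  case False
  show ?thesis
  proof (rule DERIV_nonpos_imp_nonincreasing[where f=\<psi>])
    show "c \<le> t" using False by simp
    show "\<exists>y. (\<psi> has_real_derivative y) (at x) \<and> y \<le> 0" if "c \<le> x" "x \<le> t" for x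
      using der[of x] down[of x] that t c by (intro exI[of _ "\<psi>' x"]) auto
  qed
qed

section \<open>The extremal inequalities on the first quadrant\<close>

text \<open>All of this comes from p \<theta> = pi/2. That cos(pt) vanishes at \<theta> gives the
  extremal values below; that (p-1)\<theta> is complementary to \<theta> places the critical points
  at \<theta>.\<close>

lemma half_angle_facts:
  fixes p \<theta> :: real
  assumes p: "1 < p" "p \<le> 2" and \<theta>: "\<theta> = pi/(2*p)"
  shows "0 < \<theta>" "\<theta> < pi/2" "0 < sin \<theta>" "0 < cos \<theta>" "cos (p*\<theta>) = 0" "sin ((p-1)*\<theta>) = cos \<theta>"
proof -
  show 1: "0 < \<theta>" and 2: "\<theta> < pi/2" using p by (auto simp: \<theta> field_simps)
  show "0 < sin \<theta>" using 1 2 by (intro sin_gt_zero) auto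
  show "0 < cos \<theta>" using 1 2 by (intro cos_gt_zero) auto
  have e: "p*\<theta> = pi/2" using p by (simp add: \<theta>)
  show "cos (p*\<theta>) = 0" by (simp add: e)
  have "(p-1)*\<theta> = pi/2 - \<theta>" using e by (simp add: algebra_simps)
  then show "sin ((p-1)*\<theta>) = cos \<theta>" by (simp add: sin_diff)
qed

lemma cos_mult_half_pi: "cos (p*(pi/2)) = - sin ((p-1)*(pi/2))" for p :: real
proof -
  have "p*(pi/2) = (p-1)*(pi/2) + pi/2" by (simp add: field_simps)
  then show ?thesis by (simp only: cos_add) simp
qed

text \<open>After division by cos^p t the left side becomes \<open>\<psi>\<close>, whose derivative
  has the sign of sin^(p-1) t - b sin((p-1)t). By \<open>sin_powr_ratio_mono\<close> with q = p-1
  this is nonnegative up to \<theta> and nonpositive after it, so \<open>\<psi>\<close> peaks at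
  \<theta>, with value tan^p \<theta> because cos(p \<theta>) = 0.\<close>

lemma sin_powr_le_first_quadrant:
  fixes p \<theta> t :: real
  assumes p: "1 < p" "p \<le> 2" and \<theta>: "\<theta> = pi/(2*p)" and t: "0 \<le> t" "t \<le> pi/2"
  shows "sin t powr p + sin \<theta> powr (p-1) / cos \<theta> * cos (p*t) \<le> tan \<theta> powr p * cos t powr p"
proof -
  note th = half_angle_facts[OF p \<theta>]
  \<comment> \<open>The coefficient that makes the two terms of the derivative of
    \<open>\<psi>\<close> balance at \<theta>, since sin((p-1)\<theta>) = cos \<theta>.\<close>
  define b where "b = sin \<theta> powr (p-1) / cos \<theta>"
  have b: "0 < b" using th by (simp add: b_def)
  have lo: "b * sin ((p-1)*x) \<le> sin x powr (p-1)" if "0 < x" "x \<le> \<theta>" for x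
    using sin_powr_ratio_mono[of "p-1" x \<theta>] that th p by (simp add: b_def field_simps)
  have hi: "sin x powr (p-1) \<le> b * sin ((p-1)*x)" if "\<theta> \<le> x" "x \<le> pi/2" for x
    using sin_powr_ratio_mono[of "p-1" \<theta> x] that th p by (simp add: b_def field_simps)
  show ?thesis
  proof (cases "t = pi/2")
    case True
    \<comment> \<open>Here cos t = 0, so \<open>\<psi>\<close> is of no use; the right side of the
      claim is 0 and the claim is \<open>hi\<close> at its right end point.\<close>
    have "sin (pi/2) powr (p-1) \<le> b * sin ((p-1)*(pi/2))" using th by (intro hi) auto
    then show ?thesis unfolding True b_def[symmetric] cos_mult_half_pi by simp
  next
    case False
    define \<psi> where "\<psi> = (\<lambda>t. (sin t powr p + b * cos (p*t)) * cos t powr (-p))"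
    have "\<psi> t \<le> \<psi> \<theta>"
    proof (rule le_at_peak[where \<psi>=\<psi> and c=\<theta> and t=t and a=0 and b="pi/2"])
      show "continuous_on {0..<pi/2} \<psi>"
      proof -
        have "cos t \<noteq> 0" if "t \<in> {0..<pi/2}" for t
          using cos_gt_zero_pi[of t] that by auto
        moreover have "0 \<le> sin t" if "t \<in> {0..<pi/2}" for t
          using that by (intro sin_ge_zero) auto
        ultimately show ?thesis unfolding \<psi>_def using p
          by (intro continuous_intros continuous_on_powr') auto
      qed
      show "(\<psi> has_real_derivative p * cos t powr (-p-1) * (sin t powr (p-1) - b * sin ((p-1)*t))) (at t)"
        if "0 < t" "t < pi/2" for t
      proof -
        have c: "0 < cos t" "0 < sin t" using that by (auto intro!: cos_gt_zero sin_gt_zero)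
        have e1: "cos t powr (-p) = cos t powr (-p-1) * cos t"
          using c powr_mult_base[of "cos t" "-p-1"] by (simp add: mult.commute)
        have e2: "sin t powr p = sin t powr (p-1) * sin t"
          using c powr_mult_base[of "sin t" "p-1"] by (simp add: mult.commute)
        have e3: "sin ((p-1)*t) = sin (p*t) * cos t - cos (p*t) * sin t"
          by (simp add: left_diff_distrib sin_diff)
        \<comment> \<open>Differentiation yields sin^(p-1) t in two pieces, with factors cos^2 t and
          sin^2 t; this identity joins them.\<close>
        have e4: "sin t powr (p-1) = sin t powr (p-1) * (cos t)^2 + sin t powr (p-1) * (sin t)^2"
          by (simp add: distrib_left[symmetric])
        have "(\<psi> has_real_derivative (p * sin t powr (p-1) * cos t - b * p * sin (p*t)) * cos t powr (-p)
            + (sin t powr p + b * cos (p*t)) * (p * cos t powr (-p-1) * sin t)) (at t)"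
          unfolding \<psi>_def using c by (auto intro!: derivative_eq_intros simp: algebra_simps)
        also have "(p * sin t powr (p-1) * cos t - b * p * sin (p*t)) * cos t powr (-p)
            + (sin t powr p + b * cos (p*t)) * (p * cos t powr (-p-1) * sin t)
           = p * cos t powr (-p-1) * ((sin t powr (p-1) * (cos t)^2 + sin t powr (p-1) * (sin t)^2) - b * sin ((p-1)*t))"
          unfolding e1 e2 e3 by (simp add: algebra_simps power2_eq_square)
        finally show ?thesis using e4 by simp
      qed
    qed (use t False lo hi p th in \<open>auto intro!: mult_nonneg_nonneg mult_nonneg_nonpos\<close>)
    moreover have "\<psi> \<theta> = tan \<theta> powr p"
      using th by (simp add: \<psi>_def tan_def powr_divide powr_minus field_simps)
    moreover have "X \<le> Y * cos t powr p" if "X * cos t powr (-p) \<le> Y" for X Y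
    proof -
      have "0 < cos t powr p" using t False cos_gt_zero_pi[of t] by simp
      then show ?thesis using that by (simp add: powr_minus field_simps)
    qed
    ultimately show ?thesis unfolding \<psi>_def b_def[symmetric] by metis
  qed
qed

text \<open>The same scheme with \<open>sin_mult_ratio_mono\<close>: after division by cos^p t the
  derivative has the sign of sin t - tan \<theta> sin((p-1)t), and the peak value at \<theta> is
  cos^(-p) \<theta>.\<close>

lemma cos_powr_ge_first_quadrant:
  fixes p \<theta> t :: real
  assumes p: "1 < p" "p \<le> 2" and \<theta>: "\<theta> = pi/(2*p)" and t: "0 \<le> t" "t \<le> pi/2"
  shows "1 + tan \<theta> * cos (p*t) \<le> cos \<theta> powr (-p) * cos t powr p"
proof -
  note th = half_angle_facts[OF p \<theta>]
  define b where "b = tan \<theta>"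
  have b: "0 < b" using th by (simp add: b_def tan_def)
  have lo: "b * sin ((p-1)*x) \<le> sin x" if "0 < x" "x \<le> \<theta>" for x
    using sin_mult_ratio_mono[of "p-1" x \<theta>] that th p by (simp add: b_def tan_def field_simps)
  have hi: "sin x \<le> b * sin ((p-1)*x)" if "\<theta> \<le> x" "x \<le> pi/2" for x
    using sin_mult_ratio_mono[of "p-1" \<theta> x] that th p by (simp add: b_def tan_def field_simps)
  show ?thesis
  proof (cases "t = pi/2")
    case True
    have "sin (pi/2) \<le> b * sin ((p-1)*(pi/2))" using th by (intro hi) auto
    then show ?thesis unfolding True b_def[symmetric] cos_mult_half_pi by simp
  next
    case False
    define \<psi> where "\<psi> = (\<lambda>t. (1 + b * cos (p*t)) * cos t powr (-p))"
    have "\<psi> t \<le> \<psi> \<theta>"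
    proof (rule le_at_peak[where \<psi>=\<psi> and c=\<theta> and t=t and a=0 and b="pi/2"])
      show "continuous_on {0..<pi/2} \<psi>"
      proof -
        have "cos t \<noteq> 0" if "t \<in> {0..<pi/2}" for t
          using cos_gt_zero_pi[of t] that by auto
        then show ?thesis unfolding \<psi>_def using p by (intro continuous_intros) auto
      qed
      show "(\<psi> has_real_derivative p * cos t powr (-p-1) * (sin t - b * sin ((p-1)*t))) (at t)"
        if "0 < t" "t < pi/2" for t
      proof -
        have c: "0 < cos t" using that by (auto intro!: cos_gt_zero)
        have e1: "cos t powr (-p) = cos t powr (-p-1) * cos t"
          using c powr_mult_base[of "cos t" "-p-1"] by (simp add: mult.commute)
        have e3: "sin ((p-1)*t) = sin (p*t) * cos t - cos (p*t) * sin t"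
          by (simp add: left_diff_distrib sin_diff)
        have "(\<psi> has_real_derivative - (b * p * sin (p*t)) * cos t powr (-p)
            + (1 + b * cos (p*t)) * (p * cos t powr (-p-1) * sin t)) (at t)"
          unfolding \<psi>_def using c by (auto intro!: derivative_eq_intros simp: algebra_simps)
        also have "- (b * p * sin (p*t)) * cos t powr (-p)
            + (1 + b * cos (p*t)) * (p * cos t powr (-p-1) * sin t)
           = p * cos t powr (-p-1) * (sin t - b * sin ((p-1)*t))"
          unfolding e1 e3 by (simp add: algebra_simps)
        finally show ?thesis .
      qed
    qed (use t False lo hi p th in \<open>auto intro!: mult_nonneg_nonneg mult_nonneg_nonpos\<close>)
    moreover have "\<psi> \<theta> = cos \<theta> powr (-p)"
      using th by (simp add: \<psi>_def)
    moreover have "X \<le> Y * cos t powr p" if "X * cos t powr (-p) \<le> Y" for X Y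
    proof -
      have "0 < cos t powr p" using t False cos_gt_zero_pi[of t] by simp
      then show ?thesis using that by (simp add: powr_minus field_simps)
    qed
    ultimately show ?thesis unfolding \<psi>_def b_def[symmetric] by metis
  qed
qed

section \<open>Passage to all arguments and to complex numbers\<close>

text \<open>The difference of the two sides is 2 sin(p pi/2) sin(p(t - pi/2)), and p <= 2 keeps both
  angles in [0, pi].\<close>

lemma cos_mult_reflect_le:
  fixes p t :: real
  assumes p: "1 < p" "p \<le> 2" and t: "pi/2 \<le> t" "t \<le> pi"
  shows "cos (p*t) \<le> cos (p*(pi-t))"
proof -
  have "0 \<le> sin (p*(pi/2))" using p by (intro sin_ge_zero) (auto simp: field_simps)
  moreover have "0 \<le> sin (p*(t-pi/2))"
  proof (intro sin_ge_zero)
    have "p*(t-pi/2) \<le> 2*(pi/2)" using p t by (intro mult_mono) auto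
    then show "p*(t-pi/2) \<le> pi" by simp
  qed (use p t in auto)
  moreover have "cos (p*(pi/2) - p*(t-pi/2)) - cos (p*(pi/2) + p*(t-pi/2)) = 2 * sin (p*(pi/2)) * sin (p*(t-pi/2))"
    by (simp add: cos_add cos_diff)
  moreover have "p*(pi/2) - p*(t-pi/2) = p*(pi-t)" "p*(pi/2) + p*(t-pi/2) = p*t"
    by (auto simp: algebra_simps)
  ultimately show ?thesis by (smt (verit) mult_nonneg_nonneg)
qed

text \<open>The reflections t -> -t and t -> pi - t preserve |sin t| and |cos t|. The first
  preserves cos(pt) too; the second, applied to second-quadrant angles, can only increase it, which
  is harmless for B >= 0. The parameter \<open>N\<close> lets one reduction serve both
  inequalities.\<close>

lemma first_quadrant_reduction:
  fixes p t A B :: real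
  assumes p: "1 < p" "p \<le> 2" and t: "\<bar>t\<bar> \<le> pi" and B: "0 \<le> B"
    and quarter: "\<And>s. 0 \<le> s \<Longrightarrow> s \<le> pi/2 \<Longrightarrow> N (sin s) + B * cos (p * s) \<le> A * cos s powr p"
  shows "N \<bar>sin t\<bar> + B * cos (p*t) \<le> A * \<bar>cos t\<bar> powr p"
proof (cases "\<bar>t\<bar> \<le> pi/2")
  case True
  have "sin \<bar>t\<bar> = \<bar>sin t\<bar>" using t sin_ge_zero[of t] sin_ge_zero[of "-t"] by (auto simp: abs_if)
  moreover have "cos \<bar>t\<bar> = \<bar>cos t\<bar>" using True cos_ge_zero[of t] by (auto simp: abs_le_iff)
  moreover have "cos (p*\<bar>t\<bar>) = cos (p*t)" by (auto simp: abs_if)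
  ultimately show ?thesis using quarter[of "\<bar>t\<bar>"] True by simp
next
  case False
  have s: "sin (pi - \<bar>t\<bar>) = \<bar>sin t\<bar>" using t sin_ge_zero[of t] sin_ge_zero[of "-t"] by (auto simp: abs_if)
  have c: "cos (pi - \<bar>t\<bar>) = \<bar>cos t\<bar>"
  proof -
    have "0 \<le> cos (pi - \<bar>t\<bar>)" using t False by (intro cos_ge_zero) auto
    then show ?thesis by (auto simp: abs_if split: if_splits)
  qed
  have "cos (p*t) \<le> cos (p*(pi - \<bar>t\<bar>))"
    using cos_mult_reflect_le[OF p, of "\<bar>t\<bar>"] t False by (auto simp: abs_if split: if_splits)
  then have "B * cos (p*t) \<le> B * cos (p*(pi - \<bar>t\<bar>))"
    using B by (rule mult_left_mono)
  moreover have "0 \<le> pi - \<bar>t\<bar>" "pi - \<bar>t\<bar> \<le> pi/2" using False t by auto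
  note quarter[OF this, unfolded s c]
  ultimately show ?thesis by linarith
qed

lemma Re_powr_real: "Re (z powr of_real p) = norm z powr p * cos (p * Arg z)" for p :: real
proof (cases "z = 0")
  case False
  then show ?thesis by (simp add: powr_def Re_exp Im_Ln_eq Arg_eq_Im_Ln Re_Ln)
qed simp

lemma abs_Re_Im_polar: "\<bar>Re z\<bar> = norm z * \<bar>cos (Arg z)\<bar>" "\<bar>Im z\<bar> = norm z * \<bar>sin (Arg z)\<bar>"
proof -
  have "z = rcis (norm z) (Arg z)" by (simp add: rcis_cmod_Arg)
  then show "\<bar>Re z\<bar> = norm z * \<bar>cos (Arg z)\<bar>" "\<bar>Im z\<bar> = norm z * \<bar>sin (Arg z)\<bar>"
    by (metis Re_rcis abs_mult abs_norm_cancel, metis Im_rcis abs_mult abs_norm_cancel)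
qed

text \<open>Every term is homogeneous of degree p in |z|, so this is the trigonometric inequality at
  \<open>Arg z\<close> scaled by |z|^p. It holds at every z, including 0 and the branch cut.\<close>

lemma abs_Im_powr_le:
  fixes p \<theta> :: real and z :: complex
  assumes p: "1 < p" "p \<le> 2" and \<theta>: "\<theta> = pi/(2*p)"
  shows "\<bar>Im z\<bar> powr p \<le> tan \<theta> powr p * \<bar>Re z\<bar> powr p
    - sin \<theta> powr (p-1) / cos \<theta> * Re (z powr of_real p)"
proof -
  have "\<bar>sin (Arg z)\<bar> powr p + sin \<theta> powr (p-1) / cos \<theta> * cos (p * Arg z) \<le> tan \<theta> powr p * \<bar>cos (Arg z)\<bar> powr p"
    using half_angle_facts[OF p \<theta>] Arg_bounded[of z]
    by (intro first_quadrant_reduction[OF p, where N="\<lambda>x. x powr p"] sin_powr_le_first_quadrant[OF p \<theta>]) (auto simp: abs_le_iff)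
  then have "norm z powr p * (\<bar>sin (Arg z)\<bar> powr p + sin \<theta> powr (p-1) / cos \<theta> * cos (p * Arg z))
     \<le> norm z powr p * (tan \<theta> powr p * \<bar>cos (Arg z)\<bar> powr p)" by (rule mult_left_mono) simp
  then show ?thesis unfolding Re_powr_real abs_Re_Im_polar by (simp add: powr_mult algebra_simps)
qed

lemma norm_powr_le:
  fixes p \<theta> :: real and z :: complex
  assumes p: "1 < p" "p \<le> 2" and \<theta>: "\<theta> = pi/(2*p)"
  shows "norm z powr p \<le> cos \<theta> powr (-p) * \<bar>Re z\<bar> powr p - tan \<theta> * Re (z powr of_real p)"
proof -
  have "1 + tan \<theta> * cos (p * Arg z) \<le> cos \<theta> powr (-p) * \<bar>cos (Arg z)\<bar> powr p"
    using half_angle_facts[OF p \<theta>] Arg_bounded[of z]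
    by (intro first_quadrant_reduction[OF p, where N="\<lambda>x. 1"] cos_powr_ge_first_quadrant[OF p \<theta>]) (auto simp: abs_le_iff tan_def)
  then have "norm z powr p * (1 + tan \<theta> * cos (p * Arg z))
     \<le> norm z powr p * (cos \<theta> powr (-p) * \<bar>cos (Arg z)\<bar> powr p)" by (rule mult_left_mono) simp
  then show ?thesis unfolding Re_powr_real abs_Re_Im_polar by (simp add: powr_mult algebra_simps)
qed

section \<open>Circle means\<close>

text \<open>Periodicity makes the t-integral of \<open>Wtt\<close> vanish, so the integral M of
  \<open>W\<close> has M'' equal to the integral of \<open>Wxx + Wtt\<close>, hence M is convex. A
  convex function with a finite limit at minus infinity is nondecreasing, and the limit bounds it
  from below.\<close>

lemma integral_ge_limit_at_bot:
  fixes W Wx Wxx Wt Wtt :: "real \<Rightarrow> real \<Rightarrow> real"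
  assumes ab: "a \<le> b" and x: "x < S"
    and dx: "\<And>x t. x < S \<Longrightarrow> t \<in> {a..b} \<Longrightarrow> ((\<lambda>x. W x t) has_real_derivative Wx x t) (at x)"
    and dxx: "\<And>x t. x < S \<Longrightarrow> t \<in> {a..b} \<Longrightarrow> ((\<lambda>x. Wx x t) has_real_derivative Wxx x t) (at x)"
    and dtt: "\<And>x t. x < S \<Longrightarrow> t \<in> {a..b} \<Longrightarrow> (Wt x has_real_derivative Wtt x t) (at t)"
    and periodic: "\<And>x. x < S \<Longrightarrow> Wt x a = Wt x b"
    and cont: "continuous_on ({..<S} \<times> {a..b}) (\<lambda>(x,t). W x t)"
      "continuous_on ({..<S} \<times> {a..b}) (\<lambda>(x,t). Wx x t)"
      "continuous_on ({..<S} \<times> {a..b}) (\<lambda>(x,t). Wxx x t)"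
    and sub: "\<And>x t. x < S \<Longrightarrow> t \<in> {a..b} \<Longrightarrow> 0 \<le> Wxx x t + Wtt x t"
    and lim: "((\<lambda>x. integral {a..b} (W x)) \<longlongrightarrow> L) at_bot"
  shows "L \<le> integral {a..b} (W x)"
proof -
  define M where "M = (\<lambda>x. integral {a..b} (W x))"
  define M' where "M' = (\<lambda>x. integral {a..b} (Wx x))"
  define M'' where "M'' = (\<lambda>x. integral {a..b} (Wxx x))"
  have slice: "u x integrable_on {a..b}"
    if "continuous_on ({..<S} \<times> {a..b}) (\<lambda>(x,t). u x t)" "x < S" for u :: "real \<Rightarrow> real \<Rightarrow> real" and x
  proof (rule integrable_continuous_real)
    have "continuous_on {a..b} (\<lambda>t. (\<lambda>(x,t). u x t) (x, t))"
      by (rule continuous_on_compose2[OF that(1)]) (auto intro!: continuous_intros that)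
    then show "continuous_on {a..b} (u x)" by simp
  qed
  have DM: "(M has_real_derivative M' x) (at x)" if "x < S" for x
  proof -
    have "((\<lambda>x. integral (cbox a b) (W x)) has_field_derivative integral (cbox a b) (Wx x)) (at x within {..<S})"
      by (rule leibniz_rule_field_derivative)
        (use that cont slice in \<open>auto intro!: has_field_derivative_at_within[OF dx]\<close>)
    then show ?thesis using that by (simp add: M_def M'_def at_within_open[of x "{..<S}"])
  qed
  have DM': "(M' has_real_derivative M'' x) (at x)" if "x < S" for x
  proof -
    have "((\<lambda>x. integral (cbox a b) (Wx x)) has_field_derivative integral (cbox a b) (Wxx x)) (at x within {..<S})"
      by (rule leibniz_rule_field_derivative)
        (use that cont slice in \<open>auto intro!: has_field_derivative_at_within[OF dxx]\<close>)
    then show ?thesis using that by (simp add: M''_def M'_def at_within_open[of x "{..<S}"])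
  qed
  have M''_nonneg: "0 \<le> M'' x" if "x < S" for x
  proof -
    have "(Wtt x has_integral (Wt x b - Wt x a)) {a..b}"
      using that by (intro fundamental_theorem_of_calculus[OF ab])
        (auto simp: has_real_derivative_iff_has_vector_derivative[symmetric]
          intro!: has_field_derivative_at_within[OF dtt])
    moreover have "(Wxx x has_integral M'' x) {a..b}"
      unfolding M''_def using slice[OF cont(3) that] by (rule integrable_integral)
    ultimately have "((\<lambda>t. Wxx x t + Wtt x t) has_integral (M'' x + (Wt x b - Wt x a))) {a..b}"
      by (intro has_integral_add)
    then have "0 \<le> M'' x + (Wt x b - Wt x a)"
      by (rule has_integral_nonneg) (rule sub[OF that])
    then show ?thesis using periodic[OF that] by simp
  qed
  have convex: "convex_on {..<S} M"
    by (rule f''_ge0_imp_convex[OF _ DM DM' M''_nonneg]) auto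
  have limM: "(M \<longlongrightarrow> L) at_bot" using lim by (simp add: M_def)
  have M'_nonneg: "0 \<le> M' y" if y: "y < S" for y
  proof (rule ccontr)
    assume neg: "\<not> 0 \<le> M' y"
    \<comment> \<open>A tangent of negative slope lies below \<open>M\<close> and tends to infinity
      at minus infinity, which contradicts the finite limit.\<close>
    have "M z \<ge> M y + M' y * (z - y)" if "z < S" for z
      using convex_on_imp_above_tangent[OF convex, of y z "M' y"] that y
        has_field_derivative_at_within[OF DM[OF y]]
      by (auto simp: interior_open)
    then have "\<forall>\<^sub>F z in at_bot. M y + M' y * (z - y) \<le> M z"
      by (rule eventually_mono[OF eventually_gt_at_bot[of S]])
    moreover have "LIM z at_bot. M y + M' y * (z - y) :> at_top"
    proof -
      have "filterlim (\<lambda>z. - M' y * z) at_bot at_bot"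
        using neg by (intro filterlim_tendsto_pos_mult_at_bot[OF tendsto_const]) (auto simp: filterlim_ident)
      then have "filterlim (\<lambda>z. M' y * z) at_top at_bot"
        by (simp add: filterlim_uminus_at_bot)
      then have "filterlim (\<lambda>z. (M y - M' y * y) + M' y * z) at_top at_bot"
        by (rule filterlim_tendsto_add_at_top[OF tendsto_const])
      then show ?thesis by (simp add: algebra_simps)
    qed
    ultimately have "LIM z at_bot. M z :> at_top" by (rule filterlim_at_top_mono[rotated])
    then show False using limM not_tendsto_and_filterlim_at_infinity[of at_bot M L]
      by (auto dest: filterlim_at_top_imp_at_infinity)
  qed
  have "M y \<le> M x" if "y < x" for y
    using that x by (intro DERIV_nonneg_imp_nondecreasing[where f=M]) (auto intro!: exI DM M'_nonneg)
  then have "\<forall>\<^sub>F y in at_bot. M y \<le> M x"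
    by (rule eventually_mono[OF eventually_gt_at_bot[of x]])
  then show ?thesis using tendsto_upperbound[OF limM] by (simp add: M_def)
qed

section \<open>Derivatives and continuity along curves\<close>

text \<open>A chain rule along an arbitrary curve \<open>f\<close>, so that one computation serves
  the derivatives in both ln r and t. The next lemma is the second-order version, with the velocity
  \<open>d\<close> now varying.\<close>

lemma has_real_derivative_Re_comp_plus:
  fixes F :: "complex \<Rightarrow> complex" and \<phi> :: "real \<Rightarrow> real" and f :: "real \<Rightarrow> complex"
  assumes f: "(f has_vector_derivative d) (at x)"
    and F: "(F has_field_derivative F') (at (f x))"
    and \<phi>: "(\<phi> has_real_derivative \<phi>') (at (Re (f x)))"
  shows "((\<lambda>x. Re (F (f x)) + C * \<phi> (Re (f x))) has_real_derivative
           Re (F' * d) + C * (\<phi>' * Re d)) (at x)"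
proof -
  have 1: "((\<lambda>x. F (f x)) has_vector_derivative (d * F')) (at x)"
    using field_vector_diff_chain_at[OF f F] by (simp add: o_def)
  have "((\<lambda>x. Re (F (f x))) has_real_derivative Re (d * F')) (at x)"
    using bounded_linear.has_vector_derivative[OF bounded_linear_Re 1]
    by (simp add: has_real_derivative_iff_has_vector_derivative)
  moreover have "((\<lambda>x. Re (f x)) has_real_derivative Re d) (at x)"
    using bounded_linear.has_vector_derivative[OF bounded_linear_Re f]
    by (simp add: has_real_derivative_iff_has_vector_derivative)
  then have "((\<lambda>x. \<phi> (Re (f x))) has_real_derivative \<phi>' * Re d) (at x)"
    by (rule DERIV_chain2[where f=\<phi> and g="\<lambda>x. Re (f x)", OF \<phi>])
  ultimately show ?thesis
    using DERIV_add[OF _ DERIV_cmult[of "\<lambda>x. \<phi> (Re (f x))" "\<phi>' * Re d" x UNIV C]]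
    by (simp add: mult.commute)
qed

lemma has_real_derivative_Re_comp_plus_2:
  fixes F1 :: "complex \<Rightarrow> complex" and \<phi>1 :: "real \<Rightarrow> real" and f d :: "real \<Rightarrow> complex"
  assumes f: "(f has_vector_derivative d x) (at x)" and d: "(d has_vector_derivative dd) (at x)"
    and F: "(F1 has_field_derivative F2) (at (f x))"
    and \<phi>: "(\<phi>1 has_real_derivative \<phi>2) (at (Re (f x)))"
  shows "((\<lambda>x. Re (F1 (f x) * d x) + C * (\<phi>1 (Re (f x)) * Re (d x))) has_real_derivative
           Re (F2 * (d x)^2 + F1 (f x) * dd) + C * (\<phi>2 * (Re (d x))^2 + \<phi>1 (Re (f x)) * Re dd)) (at x)"
proof -
  have 1: "((\<lambda>x. F1 (f x)) has_vector_derivative (d x * F2)) (at x)"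
    using field_vector_diff_chain_at[OF f F] by (simp add: o_def)
  have 2: "((\<lambda>x. F1 (f x) * d x) has_vector_derivative (F1 (f x) * dd + d x * F2 * d x)) (at x)"
    by (rule has_vector_derivative_mult[OF 1 d])
  have R: "((\<lambda>x. Re (F1 (f x) * d x)) has_real_derivative Re (F1 (f x) * dd + d x * F2 * d x)) (at x)"
    using bounded_linear.has_vector_derivative[OF bounded_linear_Re 2]
    by (simp only: has_real_derivative_iff_has_vector_derivative)
  have rf: "((\<lambda>x. Re (f x)) has_real_derivative Re (d x)) (at x)"
    using bounded_linear.has_vector_derivative[OF bounded_linear_Re f]
    by (simp add: has_real_derivative_iff_has_vector_derivative)
  have rd: "((\<lambda>x. Re (d x)) has_real_derivative Re dd) (at x)"
    using bounded_linear.has_vector_derivative[OF bounded_linear_Re d]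
    by (simp add: has_real_derivative_iff_has_vector_derivative)
  note p = DERIV_cmult[OF DERIV_mult[OF DERIV_chain2[where f=\<phi>1 and g="\<lambda>x. Re (f x)", OF \<phi> rf] rd], of C]
  show ?thesis
    by (rule DERIV_cong[OF DERIV_add[OF R p]]) (simp add: power2_eq_square algebra_simps)
qed

lemma has_vector_derivative_add_cnj:
  fixes c :: "real \<Rightarrow> complex"
  assumes c: "(c has_vector_derivative e) (at x)"
    and G: "(G has_field_derivative G') (at (c x))" and H: "(H has_field_derivative H') (at (c x))"
  shows "((\<lambda>x. G (c x) + cnj (H (c x))) has_vector_derivative (e * G' + cnj (e * H'))) (at x)"
  using has_vector_derivative_add[OF field_vector_diff_chain_at[OF c G]
      bounded_linear.has_vector_derivative[OF bounded_linear_cnj field_vector_diff_chain_at[OF c H]]]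
  by (simp add: o_def)

lemma continuous_on_powr_slit:
  fixes f :: "'a::topological_space \<Rightarrow> complex"
  assumes "continuous_on A f" "\<And>x. x \<in> A \<Longrightarrow> f x \<notin> \<real>\<^sub>\<le>\<^sub>0"
  shows "continuous_on A (\<lambda>x. f x powr a)"
proof (rule continuous_on_powr_complex[OF _ _ assms(1) continuous_on_const])
  show "A \<subseteq> {x. 0 \<le> Re (f x) \<or> Im (f x) \<noteq> 0}"
    using assms(2) by (force simp: complex_nonpos_Reals_iff)
  show "0 < Re a" if "x \<in> A" "f x = 0" for x
    using assms(2)[OF that(1)] that(2) by simp
qed

lemma isCont_circle_mean:
  fixes Q :: "complex \<Rightarrow> real"
  assumes R: "0 < R" and Q: "continuous_on (ball 0 R) Q"
  shows "isCont (\<lambda>r. integral {0..2*pi} (\<lambda>t. Q (of_real r * exp (\<i> * of_real t)))) 0"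
proof -
  have "continuous_on ({-R<..<R} \<times> cbox 0 (2*pi)) (\<lambda>(r,t). Q (of_real r * exp (\<i> * of_real t)))"
    unfolding case_prod_unfold
    by (rule continuous_on_compose2[OF Q]) (auto intro!: continuous_intros simp: norm_mult)
  then have "continuous_on {-R<..<R} (\<lambda>r. integral (cbox 0 (2*pi)) (\<lambda>t. Q (of_real r * exp (\<i> * of_real t))))"
    by (rule integral_continuous_on_param)
  then show ?thesis using R by (simp add: continuous_on_eq_continuous_at)
qed

section \<open>A smooth replacement for |x|^p\<close>

text \<open>For p < 2 the second derivative of |x|^p is unbounded near 0; adding \<delta>^2 under
  the power makes the function smooth on the whole line.\<close>

lemma regularized_abs_powr_derivs:
  fixes p \<delta> x :: real
  assumes \<delta>: "0 < \<delta>"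
  shows "((\<lambda>x. (x\<^sup>2 + \<delta>\<^sup>2) powr (p/2)) has_real_derivative p * x * (x\<^sup>2 + \<delta>\<^sup>2) powr (p/2 - 1)) (at x)"
    and "((\<lambda>x. p * x * (x\<^sup>2 + \<delta>\<^sup>2) powr (p/2 - 1)) has_real_derivative
      p * (x\<^sup>2 + \<delta>\<^sup>2) powr (p/2 - 1) + p * (p - 2) * x\<^sup>2 * (x\<^sup>2 + \<delta>\<^sup>2) powr (p/2 - 2)) (at x)"
proof -
  have pos: "0 < x\<^sup>2 + \<delta>\<^sup>2" using \<delta> by (simp add: add_nonneg_pos)
  have D: "((\<lambda>x. (x\<^sup>2 + \<delta>\<^sup>2) powr a) has_real_derivative a * (x\<^sup>2 + \<delta>\<^sup>2) powr (a - 1) * (2 * x)) (at x)" for a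
    using DERIV_fun_powr[of "\<lambda>x. x\<^sup>2 + \<delta>\<^sup>2" "2 * x" x a] pos by (auto intro!: derivative_eq_intros)
  show "((\<lambda>x. (x\<^sup>2 + \<delta>\<^sup>2) powr (p/2)) has_real_derivative p * x * (x\<^sup>2 + \<delta>\<^sup>2) powr (p/2 - 1)) (at x)"
    by (rule DERIV_cong[OF D]) simp
  have "((\<lambda>x. p * x) has_real_derivative p) (at x)" by (auto intro!: derivative_eq_intros)
  from DERIV_mult[OF this D[of "p/2 - 1"]]
  show "((\<lambda>x. p * x * (x\<^sup>2 + \<delta>\<^sup>2) powr (p/2 - 1)) has_real_derivative
      p * (x\<^sup>2 + \<delta>\<^sup>2) powr (p/2 - 1) + p * (p - 2) * x\<^sup>2 * (x\<^sup>2 + \<delta>\<^sup>2) powr (p/2 - 2)) (at x)"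
    by (rule DERIV_cong) (simp add: field_simps power2_eq_square)
qed

text \<open>With Y = x^2 + \<delta>^2, the difference of the two sides is p (2 - p) \<delta>^2
  Y^(p/2 - 2).\<close>

lemma regularized_abs_powr_deriv2_ge:
  fixes p \<delta> x :: real
  assumes \<delta>: "0 < \<delta>" and p: "1 < p" "p \<le> 2"
  shows "p * (p - 1) * (x\<^sup>2 + \<delta>\<^sup>2) powr (p/2 - 1) \<le>
     p * (x\<^sup>2 + \<delta>\<^sup>2) powr (p/2 - 1) + p * (p - 2) * x\<^sup>2 * (x\<^sup>2 + \<delta>\<^sup>2) powr (p/2 - 2)"
proof -
  define Y where "Y = x\<^sup>2 + \<delta>\<^sup>2"
  have Y: "0 < Y" using \<delta> by (simp add: Y_def add_nonneg_pos)
  have e: "Y powr (p/2 - 1) = Y powr (p/2 - 2) * Y"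
    using Y powr_mult_base[of Y "p/2-2"] by (simp add: mult.commute)
  have "0 \<le> p * Y powr (p/2-2) * ((2 - p) * \<delta>\<^sup>2)" using p by simp
  also have "\<dots> = p * Y powr (p/2 - 1) + p * (p - 2) * x\<^sup>2 * Y powr (p/2 - 2) - p * (p - 1) * Y powr (p/2 - 1)"
    unfolding e by (simp add: Y_def algebra_simps)
  finally show ?thesis by (simp add: Y_def)
qed

text \<open>Since |w| >= m, (Re w)^2 + \<delta>^2 is at most (1 + \<delta>^2/m^2) |w|^2; the
  nonpositive exponent p/2 - 1 reverses this. The extra factor tends to 1 with \<delta>.\<close>

lemma norm_powr_le_regularized:
  fixes p \<delta> m :: real and w :: complex
  assumes p: "p \<le> 2" and \<delta>: "0 < \<delta>" and m: "0 < m" "m \<le> norm w"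
  shows "norm w powr (p - 2) \<le> (1 + \<delta>\<^sup>2 / m\<^sup>2) powr (1 - p/2) * ((Re w)\<^sup>2 + \<delta>\<^sup>2) powr (p/2 - 1)"
proof -
  define k where "k = 1 + \<delta>\<^sup>2 / m\<^sup>2"
  have k: "0 < k" using m by (simp add: k_def add_pos_nonneg)
  have w: "0 < norm w" using m by linarith
  have "\<delta>\<^sup>2 * m\<^sup>2 \<le> \<delta>\<^sup>2 * (norm w)\<^sup>2" using m by (intro mult_left_mono power_mono) auto
  then have "\<delta>\<^sup>2 \<le> \<delta>\<^sup>2 / m\<^sup>2 * (norm w)\<^sup>2" using m by (simp add: field_simps)
  moreover have "(Re w)\<^sup>2 \<le> (norm w)\<^sup>2" by (simp add: cmod_power2)
  ultimately have le: "(Re w)\<^sup>2 + \<delta>\<^sup>2 \<le> k * (norm w)\<^sup>2" by (simp add: k_def algebra_simps)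
  have pos: "0 < (Re w)\<^sup>2 + \<delta>\<^sup>2" using \<delta> by (simp add: add_nonneg_pos)
  have "(k * (norm w)\<^sup>2) powr (p/2 - 1) \<le> ((Re w)\<^sup>2 + \<delta>\<^sup>2) powr (p/2 - 1)"
    using p le pos by (intro powr_mono2') auto
  moreover have "(k * (norm w)\<^sup>2) powr (p/2 - 1) = k powr (p/2 - 1) * norm w powr (p - 2)"
  proof -
    have "(norm w)\<^sup>2 = norm w powr 2" using w by simp
    then show ?thesis using k by (simp only: powr_mult powr_powr) (simp add: algebra_simps)
  qed
  moreover have "k powr (1 - p/2) * k powr (p/2 - 1) = 1"
    using k by (simp flip: powr_add)
  ultimately show ?thesis
    unfolding k_def[symmetric]
    by (smt (verit) mult.assoc mult_cancel_right2 mult_left_mono powr_ge_zero mult_1)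
qed

text \<open>In the logarithmic coordinate \<open>s = ln r + \<i> t\<close> the circle mean is an integral over a vertical
  segment. There the Laplacian of the integrand is nonnegative: the Laplacian of \<open>Re (f powr p)\<close> is
  \<open>4 Re (F'' (f) g' cnj h')\<close> with \<open>F = (\<lambda>w. w powr p)\<close>, and it is dominated by that of the
  regularised \<open>\<bar>Re f\<bar> powr p\<close>, which is at least a multiple of \<open>\<bar>g' + h'\<bar>\<^sup>2\<close>.\<close>

lemma circle_mean_regularized_ge:
  fixes f g h :: "complex \<Rightarrow> complex" and p \<kappa> \<delta> m r R :: real
  defines "Q \<equiv> \<lambda>w. Re (w powr of_real p) + \<kappa> * (1 + \<delta>\<^sup>2 / m\<^sup>2) powr (1 - p/2) * ((Re w)\<^sup>2 + \<delta>\<^sup>2) powr (p/2)"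
  assumes p: "1 < p" "p \<le> 2" and \<kappa>: "0 \<le> \<kappa>" and \<delta>: "0 < \<delta>" and m: "0 < m" and r: "0 < r" "r < R"
    and g: "g holomorphic_on ball 0 R" and h: "h holomorphic_on ball 0 R"
    and f: "f = (\<lambda>z. g z + cnj (h z))"
    and avoid: "\<And>z. z \<in> ball 0 R \<Longrightarrow> f z \<notin> \<real>\<^sub>\<le>\<^sub>0"
    and lower: "\<And>z. z \<in> ball 0 R \<Longrightarrow> m \<le> norm (f z)"
    and dil: "\<And>z. z \<in> ball 0 R \<Longrightarrow>
      4 * (norm (deriv g z) * norm (deriv h z)) \<le> \<kappa> * (norm (deriv g z + deriv h z))\<^sup>2"
  shows "2 * pi * Q (f 0) \<le> integral {0..2*pi} (\<lambda>t. Q (f (of_real r * exp (\<i> * of_real t))))"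
proof -
  \<comment> \<open>The exponential maps the half-plane Re s < \<open>S\<close> onto the punctured
    disk of radius \<open>R\<close>.\<close>
  define S where "S = ln R"
  have expS: "exp s \<in> ball 0 R" if "Re s < S" for s :: complex
  proof -
    have "exp (Re s) < exp S" using that by simp
    then show ?thesis using r by (simp add: S_def)
  qed
  define A where "A = (1 + \<delta>\<^sup>2 / m\<^sup>2) powr (1 - p/2)"
  define B where "B = \<kappa> * A"
  have A: "0 \<le> A" by (simp add: A_def)
  define F1 where "F1 = (\<lambda>w::complex. of_real p * w powr (of_real p - 1))"
  define F2 where "F2 = (\<lambda>w::complex. of_real p * ((of_real p - 1) * w powr (of_real p - 1 - 1)))"
  define \<phi> where "\<phi> = (\<lambda>x. (x\<^sup>2 + \<delta>\<^sup>2) powr (p/2))"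
  define \<phi>1 where "\<phi>1 = (\<lambda>x. p * x * (x\<^sup>2 + \<delta>\<^sup>2) powr (p/2 - 1))"
  define \<phi>2 where "\<phi>2 = (\<lambda>x. p * (x\<^sup>2 + \<delta>\<^sup>2) powr (p/2 - 1) + p * (p - 2) * x\<^sup>2 * (x\<^sup>2 + \<delta>\<^sup>2) powr (p/2 - 2))"
  \<comment> \<open>Here \<open>f'\<close> is no derivative but \<open>f\<close> in the coordinate
    s; \<open>G1\<close>, \<open>H1\<close> and \<open>G2\<close>, \<open>H2\<close> are the first
    and second derivatives of g and h in that coordinate.\<close>
  define f' where "f' = (\<lambda>s. g (exp s) + cnj (h (exp s)))"
  define G1 where "G1 = (\<lambda>s::complex. deriv g (exp s) * exp s)"
  define H1 where "H1 = (\<lambda>s::complex. deriv h (exp s) * exp s)"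
  define G2 where "G2 = (\<lambda>s. deriv (deriv g) (exp s) * exp s * exp s + deriv g (exp s) * exp s)"
  define H2 where "H2 = (\<lambda>s. deriv (deriv h) (exp s) * exp s * exp s + deriv h (exp s) * exp s)"
  \<comment> \<open>First and second derivatives of \<open>f'\<close> in the direction
    \<open>e\<close>; e = 1 stands for ln r and e = \<i> for t.\<close>
  define d where "d = (\<lambda>e s. e * G1 s + cnj (e * H1 s))"
  define dd where "dd = (\<lambda>e s. e * (e * G2 s) + cnj (e * (e * H2 s)))"
  define V where "V = (\<lambda>s. Re (f' s powr of_real p) + B * \<phi> (Re (f' s)))"
  define V1 where "V1 = (\<lambda>e s. Re (F1 (f' s) * d e s) + B * (\<phi>1 (Re (f' s)) * Re (d e s)))"
  define V2 where "V2 = (\<lambda>e s. Re (F2 (f' s) * (d e s)\<^sup>2 + F1 (f' s) * dd e s)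
      + B * (\<phi>2 (Re (f' s)) * (Re (d e s))\<^sup>2 + \<phi>1 (Re (f' s)) * Re (dd e s)))"
  have f'_avoid: "f' s \<notin> \<real>\<^sub>\<le>\<^sub>0" if "Re s < S" for s
    using avoid[OF expS[OF that]] by (simp add: f'_def f)
  have F1: "((\<lambda>w. w powr of_real p) has_field_derivative F1 w) (at w)" if "w \<notin> \<real>\<^sub>\<le>\<^sub>0" for w
    unfolding F1_def by (rule has_field_derivative_powr[OF that])
  have F2: "(F1 has_field_derivative F2 w) (at w)" if "w \<notin> \<real>\<^sub>\<le>\<^sub>0" for w
    unfolding F1_def F2_def by (rule DERIV_cmult[OF has_field_derivative_powr[OF that]])
  have gh: "(k has_field_derivative deriv k w) (at w)" if "k holomorphic_on ball 0 R" "w \<in> ball 0 R" for k w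
    using that by (intro holomorphic_derivI[of k "ball 0 R"]) auto
  have gh2: "deriv k holomorphic_on ball 0 R" if "k holomorphic_on ball 0 R" for k
    using that by (intro holomorphic_deriv) auto
  have dexp: "((\<lambda>s. k (exp s)) has_field_derivative deriv k (exp s) * exp s) (at s)"
    if "k holomorphic_on ball 0 R" "Re s < S" for k s
    by (rule DERIV_chain2[where f=k, OF gh[OF that(1) expS[OF that(2)]] DERIV_exp])
  have dexp2: "((\<lambda>s. e * (deriv k (exp s) * exp s)) has_field_derivative
      e * (deriv (deriv k) (exp s) * exp s * exp s + deriv k (exp s) * exp s)) (at s)"
    if "k holomorphic_on ball 0 R" "Re s < S" for k s e
    by (rule DERIV_cmult[OF DERIV_cong[OF DERIV_mult[OF dexp[OF gh2[OF that(1)] that(2)] DERIV_exp]]]) simp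
  have Df: "((\<lambda>x. f' (c x)) has_vector_derivative d e (c x)) (at x)"
    if "(c has_vector_derivative e) (at x)" "Re (c x) < S" for c e x
    unfolding f'_def d_def G1_def H1_def
    by (rule has_vector_derivative_add_cnj[OF that(1) dexp[OF g that(2)] dexp[OF h that(2)]])
  have Dd: "((\<lambda>x. d e (c x)) has_vector_derivative dd e (c x)) (at x)"
    if "(c has_vector_derivative e) (at x)" "Re (c x) < S" for c e x
    unfolding d_def dd_def G1_def H1_def G2_def H2_def
    by (rule has_vector_derivative_add_cnj[OF that(1) dexp2[OF g that(2)] dexp2[OF h that(2)]])
  have DV: "((\<lambda>x. V (c x)) has_real_derivative V1 e (c x)) (at x)"
    if "(c has_vector_derivative e) (at x)" "Re (c x) < S" for c e x
    unfolding V_def V1_def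
    by (rule has_real_derivative_Re_comp_plus[OF Df[OF that] F1[OF f'_avoid[OF that(2)]]])
      (simp add: \<phi>_def \<phi>1_def regularized_abs_powr_derivs[OF \<delta>])
  have DV1: "((\<lambda>x. V1 e (c x)) has_real_derivative V2 e (c x)) (at x)"
    if "(c has_vector_derivative e) (at x)" "Re (c x) < S" for c e x
    unfolding V1_def V2_def
    by (rule has_real_derivative_Re_comp_plus_2[OF Df[OF that] Dd[OF that] F2[OF f'_avoid[OF that(2)]]])
      (simp add: \<phi>1_def \<phi>2_def regularized_abs_powr_derivs[OF \<delta>])
  have laplace: "0 \<le> V2 1 s + V2 \<i> s" if s: "Re s < S" for s
  proof -
    define w where "w = f' s"
    define u where "u = Re w"
    \<comment> \<open>Since \<open>d 1\<close> is G1 + cnj H1 and \<open>d \<i>\<close> is \<i> (G1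
      - cnj H1), the squares add up to 4 G1 cnj H1, and the real parts are those of G1 + H1 and \<i>
      (G1 + H1). The second-order terms cancel because \<open>f'\<close> is harmonic.\<close>
    have sumsq: "(d 1 s)\<^sup>2 + (d \<i> s)\<^sup>2 = 4 * (G1 s * cnj (H1 s))"
      by (simp add: d_def power2_eq_square algebra_simps)
    have sumdd: "dd 1 s + dd \<i> s = 0" by (simp add: dd_def)
    have sumre: "(Re (d 1 s))\<^sup>2 + (Re (d \<i> s))\<^sup>2 = (norm (G1 s + H1 s))\<^sup>2"
      unfolding cmod_power2 by (simp add: d_def power2_eq_square algebra_simps)
    have eq: "V2 1 s + V2 \<i> s = Re (F2 w * ((d 1 s)\<^sup>2 + (d \<i> s)\<^sup>2) + F1 w * (dd 1 s + dd \<i> s))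
       + B * (\<phi>2 u * ((Re (d 1 s))\<^sup>2 + (Re (d \<i> s))\<^sup>2) + \<phi>1 u * Re (dd 1 s + dd \<i> s))"
      unfolding V2_def w_def[symmetric] u_def[symmetric] by (simp add: algebra_simps)
    define N where "N = (norm (G1 s + H1 s))\<^sup>2"
    have dil': "4 * (norm (G1 s) * norm (H1 s)) \<le> \<kappa> * N"
    proof -
      have "G1 s + H1 s = (deriv g (exp s) + deriv h (exp s)) * exp s"
        by (simp add: G1_def H1_def algebra_simps)
      then have N: "N = (norm (deriv g (exp s) + deriv h (exp s)))\<^sup>2 * (norm (exp s))\<^sup>2"
        by (simp add: N_def norm_mult power_mult_distrib)
      have "4 * (norm (G1 s) * norm (H1 s)) = 4 * (norm (deriv g (exp s)) * norm (deriv h (exp s))) * (norm (exp s))\<^sup>2"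
        by (simp add: G1_def H1_def norm_mult power2_eq_square)
      also have "\<dots> \<le> \<kappa> * (norm (deriv g (exp s) + deriv h (exp s)))\<^sup>2 * (norm (exp s))\<^sup>2"
        by (intro mult_right_mono dil expS s) simp
      finally show ?thesis by (simp add: N mult.assoc)
    qed
    have nF2: "norm (F2 w) = p * (p - 1) * norm w powr (p - 2)"
    proof -
      have "complex_of_real p - 1 = of_real (p - 1)" "complex_of_real p - 1 - 1 = of_real (p - 2)" by auto
      then show ?thesis unfolding F2_def using p
        by (simp only: norm_mult norm_of_real norm_powr_real_powr' Re_complex_of_real Reals_of_real)
    qed
    have mw: "m \<le> norm w" using lower[OF expS[OF s]] by (simp add: w_def f'_def f)
    have "norm (F2 w) \<le> A * \<phi>2 u"
    proof -
      have "norm (F2 w) \<le> p * (p - 1) * (A * (u\<^sup>2 + \<delta>\<^sup>2) powr (p/2 - 1))"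
        unfolding nF2 A_def u_def using p norm_powr_le_regularized[OF p(2) \<delta> m mw]
        by (intro mult_left_mono) auto
      also have "\<dots> = A * (p * (p - 1) * (u\<^sup>2 + \<delta>\<^sup>2) powr (p/2 - 1))" by simp
      also have "\<dots> \<le> A * \<phi>2 u"
        unfolding \<phi>2_def by (intro mult_left_mono regularized_abs_powr_deriv2_ge \<delta> p A)
      finally show ?thesis .
    qed
    have "norm (F2 w * (4 * (G1 s * cnj (H1 s)))) = norm (F2 w) * (4 * (norm (G1 s) * norm (H1 s)))"
      by (simp add: norm_mult)
    also have "\<dots> \<le> norm (F2 w) * (\<kappa> * N)" by (intro mult_left_mono dil') simp
    also have "\<dots> \<le> A * \<phi>2 u * (\<kappa> * N)"
      using \<kappa> \<open>norm (F2 w) \<le> A * \<phi>2 u\<close> by (intro mult_right_mono) (auto simp: N_def)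
    finally have "- (B * (\<phi>2 u * N)) \<le> Re (F2 w * (4 * (G1 s * cnj (H1 s))))"
      using abs_Re_le_cmod[of "F2 w * (4 * (G1 s * cnj (H1 s)))"] by (simp add: B_def mult_ac)
    then show ?thesis
      unfolding eq sumsq sumdd sumre N_def[symmetric] by simp
  qed
  have cdom: "continuous_on {s. Re s < S} (\<lambda>s. k (exp s))" if "k holomorphic_on ball 0 R" for k
    by (rule continuous_on_compose2[OF holomorphic_on_imp_continuous_on[OF that]])
      (use expS in \<open>auto intro!: continuous_intros\<close>)
  have cf': "continuous_on {s. Re s < S} f'"
    unfolding f'_def by (intro continuous_intros cdom g h)
  have cpowr: "continuous_on {s. Re s < S} (\<lambda>s. f' s powr a)" for a
    using f'_avoid by (intro continuous_on_powr_slit[OF cf']) auto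
  have c\<phi>: "continuous_on {s. Re s < S} (\<lambda>s. ((Re (f' s))\<^sup>2 + \<delta>\<^sup>2) powr a)" for a
  proof -
    have "(Re (f' s))\<^sup>2 + \<delta>\<^sup>2 \<noteq> 0" for s using \<delta> by (simp add: sum_power2_eq_zero_iff)
    then show ?thesis by (intro continuous_intros cf') auto
  qed
  have cd: "continuous_on {s. Re s < S} (d 1)"
    unfolding d_def G1_def H1_def by (intro continuous_intros cdom gh2 g h)
  have cdd: "continuous_on {s. Re s < S} (dd 1)"
    unfolding dd_def G2_def H2_def by (intro continuous_intros cdom gh2 g h)
  have cV: "continuous_on {s. Re s < S} V" "continuous_on {s. Re s < S} (V1 1)" "continuous_on {s. Re s < S} (V2 1)"
    unfolding V_def V1_def V2_def F1_def F2_def \<phi>_def \<phi>1_def \<phi>2_def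
    by (intro cf' cpowr c\<phi> cd cdd continuous_on_add continuous_on_mult continuous_on_const
        continuous_on_Re continuous_on_power)+
  define c where "c = (\<lambda>x t. complex_of_real x + \<i> * of_real t)"
  have Rec: "Re (c x t) = x" for x t by (simp add: c_def)
  have c1: "((\<lambda>x. c x t) has_vector_derivative 1) (at x)" for x t
    unfolding c_def by (auto intro!: derivative_eq_intros)
  have c2: "((\<lambda>t. c x t) has_vector_derivative \<i>) (at t)" for x t
    unfolding c_def by (auto intro!: derivative_eq_intros)
  have cW: "continuous_on ({..<S} \<times> {0..2*pi}) (\<lambda>(x,t). U (c x t))"
    if "continuous_on {s. Re s < S} U" for U :: "complex \<Rightarrow> real"
    unfolding case_prod_unfold
    by (rule continuous_on_compose2[OF that]) (auto simp: c_def intro!: continuous_intros)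
  have expc: "exp (c x t) = of_real (exp x) * exp (\<i> * of_real t)" for x t
    by (simp add: c_def exp_add exp_of_real)
  have VQ: "V (c x t) = Q (f (of_real (exp x) * exp (\<i> * of_real t)))" for x t
    by (simp add: V_def Q_def f'_def f expc B_def A_def \<phi>_def)
  have lim: "((\<lambda>x. integral {0..2*pi} (\<lambda>t. V (c x t))) \<longlongrightarrow> 2 * pi * Q (f 0)) at_bot"
  proof -
    have cont: "continuous_on (ball 0 R) (\<lambda>z. Q (f z))"
    proof -
      have cf: "continuous_on (ball 0 R) f"
        unfolding f by (intro continuous_intros holomorphic_on_imp_continuous_on g h)
      have "(Re (f s))\<^sup>2 + \<delta>\<^sup>2 \<noteq> 0" for s using \<delta> by (simp add: sum_power2_eq_zero_iff)
      then have "continuous_on (ball 0 R) (\<lambda>z. ((Re (f z))\<^sup>2 + \<delta>\<^sup>2) powr (p/2))"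
        by (intro continuous_intros cf) auto
      moreover have "continuous_on (ball 0 R) (\<lambda>z. f z powr of_real p)"
        by (rule continuous_on_powr_slit[OF cf avoid])
      ultimately show ?thesis unfolding Q_def
        by (intro continuous_on_add continuous_on_mult continuous_on_const continuous_on_Re)
    qed
    \<comment> \<open>The radius exp x tends to 0, and on the circle of radius 0 the integrand is
      the constant Q(f(0)).\<close>
    have "((\<lambda>x. integral {0..2*pi} (\<lambda>t. Q (f (of_real (exp x) * exp (\<i> * of_real t)))))
        \<longlongrightarrow> integral {0..2*pi} (\<lambda>t. Q (f (of_real 0 * exp (\<i> * of_real t))))) at_bot"
      by (rule isCont_tendsto_compose[OF isCont_circle_mean[OF _ cont] exp_at_bot]) (use r in simp)
    then show ?thesis by (simp add: VQ)
  qed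
  have "2 * pi * Q (f 0) \<le> integral {0..2*pi} (\<lambda>t. V (c (ln r) t))"
  proof (rule integral_ge_limit_at_bot[where W="\<lambda>x t. V (c x t)" and Wx="\<lambda>x t. V1 1 (c x t)" and S=S
      and Wxx="\<lambda>x t. V2 1 (c x t)" and Wt="\<lambda>x t. V1 \<i> (c x t)" and Wtt="\<lambda>x t. V2 \<i> (c x t)"])
    show "ln r < S" using r by (simp add: S_def)
    \<comment> \<open>\<open>V1\<close> depends on s only through exp s, which has period 2 pi
      \<i>.\<close>
    show "V1 \<i> (c x 0) = V1 \<i> (c x (2*pi))" for x
    proof -
      have "exp (c x 0) = exp (c x (2*pi))" by (simp add: expc mult.commute[of \<i>])
      then show ?thesis by (simp add: V1_def f'_def d_def G1_def H1_def)
    qed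
  qed (auto intro!: DV[OF c1] DV1[OF c1] DV1[OF c2] cW cV laplace lim simp: Rec)
  then show ?thesis using r by (simp add: VQ)
qed

section \<open>Limit passages: removing \<delta> and admitting the value 0\<close>

lemma square_powr_half: "(x\<^sup>2) powr (p/2) = \<bar>x\<bar> powr p" for x p :: real
proof (cases "x = 0")
  case False
  then have "x\<^sup>2 = \<bar>x\<bar> powr 2" by simp
  then show ?thesis by (simp only: powr_powr) simp
qed simp

text \<open>Let \<delta> tend to 0 in the regularized inequality: the integrand is jointly
  continuous in \<delta> and t, so its integral \<open>J\<close> converges to \<open>J 0\<close>,
  where the regularized power is |Re f|^p and the correction factor is 1.\<close>

lemma circle_mean_Re_powr_ge_slit:
  fixes f g h :: "complex \<Rightarrow> complex" and p \<kappa> r :: real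
  assumes p: "1 < p" "p \<le> 2" and \<kappa>: "0 \<le> \<kappa>" and r: "0 < r" "r < 1"
    and g: "g holomorphic_on ball 0 1" and h: "h holomorphic_on ball 0 1"
    and f: "f = (\<lambda>z. g z + cnj (h z))"
    and avoid: "\<And>z. z \<in> ball 0 1 \<Longrightarrow> f z \<notin> \<real>\<^sub>\<le>\<^sub>0"
    and dil: "\<And>z. z \<in> ball 0 1 \<Longrightarrow>
      4 * (norm (deriv g z) * norm (deriv h z)) \<le> \<kappa> * (norm (deriv g z + deriv h z))\<^sup>2"
  shows "2 * pi * Re (f 0 powr of_real p) \<le> integral {0..2*pi} (\<lambda>t.
    Re (f (of_real r * exp (\<i> * of_real t)) powr of_real p) + \<kappa> * \<bar>Re (f (of_real r * exp (\<i> * of_real t)))\<bar> powr p)"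
proof -
  \<comment> \<open>An intermediate radius: on the compact disk of radius \<open>R\<close> the
    nonvanishing |f| attains a positive minimum, which serves as \<open>m\<close>.\<close>
  define R where "R = (1 + r) / 2"
  have R: "r < R" "R < 1" "0 < R" using r by (auto simp: R_def)
  have sub: "cball 0 R \<subseteq> ball (0::complex) 1" using R by auto
  have cf: "continuous_on (ball 0 1) f"
    unfolding f by (intro continuous_intros holomorphic_on_imp_continuous_on g h)
  have "continuous_on (cball 0 R) (\<lambda>z. norm (f z))"
    using continuous_on_subset[OF cf sub] by (intro continuous_intros)
  moreover have "cball (0::complex) R \<noteq> {}" using R by simp
  ultimately obtain z0 where z0: "z0 \<in> cball 0 R" "\<And>z. z \<in> cball 0 R \<Longrightarrow> norm (f z0) \<le> norm (f z)"
    using continuous_attains_inf[OF compact_cball] by blast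
  define m where "m = norm (f z0)"
  have "f z0 \<notin> \<real>\<^sub>\<le>\<^sub>0" using z0(1) sub by (intro avoid) auto
  then have m: "0 < m" by (auto simp: m_def)
  define e where "e = (\<lambda>t::real. of_real r * exp (\<i> * of_real t) :: complex)"
  define J where "J = (\<lambda>\<delta>. integral {0..2*pi} (\<lambda>t. Re (f (e t) powr of_real p)
      + \<kappa> * (1 + \<delta>\<^sup>2 / m\<^sup>2) powr (1 - p/2) * ((Re (f (e t)))\<^sup>2 + \<delta>\<^sup>2) powr (p/2)))"
  have e_ball: "e t \<in> ball 0 1" for t using r by (simp add: e_def norm_mult)
  have "2 * pi * Re (f 0 powr of_real p) \<le> J \<delta>" if \<delta>: "0 < \<delta>" for \<delta>
  proof -
    \<comment> \<open>The regularized term at the center is nonnegative and can be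
      discarded.\<close>
    have "2 * pi * Re (f 0 powr of_real p) \<le> 2 * pi * (Re (f 0 powr of_real p)
      + \<kappa> * (1 + \<delta>\<^sup>2 / m\<^sup>2) powr (1 - p/2) * ((Re (f 0))\<^sup>2 + \<delta>\<^sup>2) powr (p/2))"
      using \<kappa> by (intro mult_left_mono) auto
    also have "\<dots> \<le> J \<delta>"
      unfolding J_def e_def
    proof (rule circle_mean_regularized_ge[OF p \<kappa> \<delta> m r(1) R(1) _ _ f])
      have "ball 0 R \<subseteq> ball (0::complex) 1" using R by auto
      then show "g holomorphic_on ball 0 R" "h holomorphic_on ball 0 R"
        using g h holomorphic_on_subset by blast+
    qed (use R z0 in \<open>auto simp: m_def intro!: avoid dil\<close>)
    finally show ?thesis .
  qed
  then have "\<forall>\<^sub>F \<delta> in at_right 0. 2 * pi * Re (f 0 powr of_real p) \<le> J \<delta>"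
    by (auto simp: eventually_at_right_less intro: eventually_mono[OF eventually_at_right_less])
  moreover have "continuous_on UNIV J"
  proof -
    have ce: "continuous_on UNIV (\<lambda>x::real \<times> real. f (e (snd x)))"
      by (rule continuous_on_compose2[OF cf]) (auto simp: e_def norm_mult abs_of_pos r intro!: continuous_intros)
    have cp: "continuous_on UNIV (\<lambda>x::real \<times> real. f (e (snd x)) powr of_real p)"
      by (rule continuous_on_powr_slit[OF ce avoid[OF e_ball]])
    have "1 + \<delta>\<^sup>2 / m\<^sup>2 \<noteq> 0" for \<delta> :: real
      using m by (smt (verit) divide_nonneg_nonneg zero_le_power2)
    then have "continuous_on (UNIV \<times> cbox 0 (2*pi)) (\<lambda>(\<delta>, t). Re (f (e t) powr of_real p)
      + \<kappa> * (1 + \<delta>\<^sup>2 / m\<^sup>2) powr (1 - p/2) * ((Re (f (e t)))\<^sup>2 + \<delta>\<^sup>2) powr (p/2))"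
      unfolding case_prod_unfold using m p
      by (intro continuous_on_subset[OF ce] continuous_on_subset[OF cp] continuous_on_add continuous_on_mult
          continuous_on_const continuous_on_Re continuous_on_powr continuous_on_powr' continuous_on_divide
          continuous_on_power continuous_on_fst continuous_on_id)
        auto
    from integral_continuous_on_param[OF this] show ?thesis by (simp add: J_def)
  qed
  then have "isCont J 0" by (simp add: continuous_on_eq_continuous_at)
  then have "(J \<longlongrightarrow> J 0) (at_right 0)"
    by (simp add: isCont_def filterlim_at_split)
  ultimately have "2 * pi * Re (f 0 powr of_real p) \<le> J 0"
    by (intro tendsto_lowerbound) auto
  then show ?thesis by (simp add: J_def e_def square_powr_half)
qed

lemma circle_mean_Re_powr_ge:
  fixes f g h :: "complex \<Rightarrow> complex" and p \<kappa> r :: real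
  assumes p: "1 < p" "p \<le> 2" and \<kappa>: "0 \<le> \<kappa>" and r: "0 < r" "r < 1"
    and g: "g holomorphic_on ball 0 1" and h: "h holomorphic_on ball 0 1"
    and f: "f = (\<lambda>z. g z + cnj (h z))"
    and avoid: "\<And>z. z \<in> ball 0 1 \<Longrightarrow> 0 \<le> Re (f z) \<or> Im (f z) \<noteq> 0"
    and dil: "\<And>z. z \<in> ball 0 1 \<Longrightarrow>
      4 * (norm (deriv g z) * norm (deriv h z)) \<le> \<kappa> * (norm (deriv g z + deriv h z))\<^sup>2"
  shows "2 * pi * Re (f 0 powr of_real p) \<le> integral {0..2*pi} (\<lambda>t.
    Re (f (of_real r * exp (\<i> * of_real t)) powr of_real p) + \<kappa> * \<bar>Re (f (of_real r * exp (\<i> * of_real t)))\<bar> powr p)"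
proof -
  define e where "e = (\<lambda>t::real. of_real r * exp (\<i> * of_real t) :: complex)"
  define J where "J = (\<lambda>\<epsilon>. integral {0..2*pi} (\<lambda>t. Re ((f (e t) + of_real \<epsilon>) powr of_real p)
      + \<kappa> * \<bar>Re (f (e t) + of_real \<epsilon>)\<bar> powr p))"
  have e_ball: "e t \<in> ball 0 1" for t using r by (simp add: e_def norm_mult)
  have cf: "continuous_on (ball 0 1) f"
    unfolding f by (intro continuous_intros holomorphic_on_imp_continuous_on g h)
  \<comment> \<open>A positive translation makes the range miss \<open>0\<close> as well.\<close>
  have "2 * pi * Re ((f 0 + of_real \<epsilon>) powr of_real p) \<le> J \<epsilon>" if \<epsilon>: "0 < \<epsilon>" for \<epsilon>
    unfolding J_def e_def
  proof (rule circle_mean_Re_powr_ge_slit[where f="\<lambda>z. f z + of_real \<epsilon>" and g="\<lambda>z. g z + of_real \<epsilon>" and h=h, OF p \<kappa> r])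
    show "(\<lambda>z. g z + of_real \<epsilon>) holomorphic_on ball 0 1" by (intro holomorphic_intros g)
    show "(\<lambda>z. f z + of_real \<epsilon>) = (\<lambda>z. (g z + of_real \<epsilon>) + cnj (h z))" by (simp add: f algebra_simps)
    fix z :: complex assume z: "z \<in> ball 0 1"
    show "f z + of_real \<epsilon> \<notin> \<real>\<^sub>\<le>\<^sub>0" using avoid[OF z] \<epsilon> by (auto simp: complex_nonpos_Reals_iff)
    have "deriv (\<lambda>z. g z + of_real \<epsilon>) z = deriv g z"
      using z g by (intro DERIV_imp_deriv) (auto intro!: derivative_eq_intros holomorphic_derivI)
    then show "4 * (norm (deriv (\<lambda>z. g z + of_real \<epsilon>) z) * norm (deriv h z))
        \<le> \<kappa> * (norm (deriv (\<lambda>z. g z + of_real \<epsilon>) z + deriv h z))\<^sup>2"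
      using dil[OF z] by simp
  qed (rule h)
  then have "\<forall>\<^sub>F \<epsilon> in at_right 0. 2 * pi * Re ((f 0 + of_real \<epsilon>) powr of_real p) \<le> J \<epsilon>"
    by (auto intro: eventually_mono[OF eventually_at_right_less])
  moreover have "(J \<longlongrightarrow> J 0) (at_right 0)"
  proof -
    have ce: "continuous_on ({0..} \<times> cbox 0 (2*pi)) (\<lambda>x::real \<times> real. f (e (snd x)) + of_real (fst x))"
      by (intro continuous_intros continuous_on_compose2[OF cf])
        (auto simp: e_def norm_mult abs_of_pos r intro!: continuous_intros)
    \<comment> \<open>A negative translation could move values onto the cut, hence \<epsilon> >= 0
      only. The power is continuous at the value 0 as well because p > 0.\<close>
    have "continuous_on ({0..} \<times> cbox 0 (2*pi)) (\<lambda>(\<epsilon>, t). Re ((f (e t) + of_real \<epsilon>) powr of_real p)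
      + \<kappa> * \<bar>Re (f (e t) + of_real \<epsilon>)\<bar> powr p)"
      unfolding case_prod_unfold
    proof (intro ce continuous_on_add continuous_on_mult continuous_on_const continuous_on_Re
        continuous_on_powr' continuous_on_powr_complex continuous_on_rabs)
      show "{0..} \<times> cbox 0 (2*pi) \<subseteq> {x. 0 \<le> Re (f (e (snd x)) + of_real (fst x)) \<or> Im (f (e (snd x)) + of_real (fst x)) \<noteq> 0}"
      proof
        fix x :: "real \<times> real" assume "x \<in> {0..} \<times> cbox 0 (2*pi)"
        then show "x \<in> {x. 0 \<le> Re (f (e (snd x)) + of_real (fst x)) \<or> Im (f (e (snd x)) + of_real (fst x)) \<noteq> 0}"
          using avoid[OF e_ball, of "snd x"] by auto
      qed
    qed (use p in auto)
    from integral_continuous_on_param[OF this] have "continuous_on {0..} J" by (simp add: J_def)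
    then have "(J \<longlongrightarrow> J 0) (at 0 within {0..})" by (simp add: continuous_on_def)
    then show ?thesis by (rule tendsto_within_subset) auto
  qed
  moreover have "((\<lambda>\<epsilon>. 2 * pi * Re ((f 0 + of_real \<epsilon>) powr of_real p)) \<longlongrightarrow> 2 * pi * Re ((f 0 + of_real 0) powr of_real p)) (at_right 0)"
  proof -
    have "continuous_on {0..} (\<lambda>\<epsilon>. 2 * pi * Re ((f 0 + of_real \<epsilon>) powr of_real p))"
      using avoid[of 0] p by (intro continuous_intros) auto
    then have "((\<lambda>\<epsilon>. 2 * pi * Re ((f 0 + of_real \<epsilon>) powr of_real p)) \<longlongrightarrow> 2 * pi * Re ((f 0 + of_real 0) powr of_real p)) (at 0 within {0..})"
      unfolding continuous_on_def by (rule bspec) simp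
    then show ?thesis by (rule tendsto_within_subset) auto
  qed
  ultimately have "2 * pi * Re ((f 0 + of_real 0) powr of_real p) \<le> J 0"
    by (intro tendsto_le[of "at_right 0" J "J 0"]) auto
  then show ?thesis by (simp add: J_def e_def)
qed

section \<open>Dilatation of quasiregular harmonic mappings\<close>

text \<open>A unit e for which e^2 a b is a nonnegative real gives e a and cnj(e b) the same
  argument, so their moduli add. Replacing e by \<i> e turns the sum into \<i> times the difference,
  so the moduli subtract.\<close>

lemma harmonic_extremal_directions:
  fixes a b :: complex
  obtains e where "norm e = 1" "norm (e * a + cnj (e * b)) = norm a + norm b"
    "norm ((\<i> * e) * a + cnj ((\<i> * e) * b)) = \<bar>norm a - norm b\<bar>"
proof -
  obtain e where e: "norm e = 1" "e * e * (a * b) = of_real (norm (a * b))"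
  proof (cases "a * b = 0")
    case True
    then show ?thesis by (intro that[of 1]) auto
  next
    case False
    \<comment> \<open>A square root of the unimodular number that rotates a b onto the positive
      axis.\<close>
    define e where "e = csqrt (cnj (a * b) / of_real (norm (a * b)))"
    have ee: "e * e = cnj (a * b) / of_real (norm (a * b))"
      unfolding e_def by (metis power2_csqrt power2_eq_square)
    have "norm (e * e) = 1" unfolding ee using False by (simp add: norm_divide norm_mult)
    then have "norm e = 1" by (metis abs_norm_cancel abs_square_eq_1 norm_mult power2_eq_square)
    moreover have "e * e * (a * b) = of_real (norm (a * b))"
    proof -
      have "cnj (a * b) * (a * b) = of_real (norm (a * b)) * of_real (norm (a * b))"
        using complex_norm_square[of "a * b"] by (simp add: power2_eq_square mult.commute)
      then show ?thesis unfolding ee using False by (simp add: field_simps)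
    qed
    ultimately show ?thesis by (rule that)
  qed
  define X where "X = e * a"
  define Y where "Y = cnj (e * b)"
  have n: "norm X = norm a" "norm Y = norm b" using e(1) by (auto simp: X_def Y_def norm_mult)
  have "X * cnj Y = of_real (norm (a * b))" using e(2) by (simp add: X_def Y_def mult_ac)
  then have re: "Re (X * cnj Y) = norm a * norm b" by (simp add: norm_mult)
  have "(norm (X + Y))\<^sup>2 = (norm X)\<^sup>2 + (norm Y)\<^sup>2 + 2 * Re (X * cnj Y)"
    "(norm (X - Y))\<^sup>2 = (norm X)\<^sup>2 + (norm Y)\<^sup>2 - 2 * Re (X * cnj Y)"
    unfolding cmod_power2 by (simp_all add: power2_eq_square algebra_simps)
  then have sq: "(norm (X + Y))\<^sup>2 = (norm a + norm b)\<^sup>2" "(norm (X - Y))\<^sup>2 = (norm a - norm b)\<^sup>2"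
    unfolding re n by (simp_all add: power2_eq_square algebra_simps)
  have "norm (X + Y) = norm a + norm b" using sq(1) by (rule power2_eq_imp_eq) auto
  moreover have "norm (X - Y) = \<bar>norm a - norm b\<bar>"
    by (rule power2_eq_imp_eq) (simp_all only: sq(2) power2_abs norm_ge_zero abs_ge_zero)
  moreover have "(\<i> * e) * a + cnj ((\<i> * e) * b) = \<i> * (X - Y)"
    by (simp add: X_def Y_def algebra_simps)
  then have "norm ((\<i> * e) * a + cnj ((\<i> * e) * b)) = norm (X - Y)"
    by (simp only: norm_mult norm_ii mult_1)
  ultimately show ?thesis
    using e(1) by (intro that[of e]) (simp_all only: X_def Y_def)
qed

lemma min_stretch_le: "norm e = 1 \<Longrightarrow> min_stretch L \<le> norm (L e)"
  unfolding min_stretch_def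
proof (rule cInf_lower)
  show "bdd_below {norm (L h) |h. norm h = 1}" by (rule bdd_belowI[of _ 0]) auto
qed auto

text \<open>Testing \<open>L\<close> in the two extremal directions gives |a| + |b| <= K ||a| -
  |b||. Squaring and subtracting (|a| - |b|)^2 leaves 4|a||b| on the left, and ||a| - |b|| <= |a +
  b| finishes.\<close>

lemma harmonic_dilatation_bound:
  fixes a b :: complex and K :: real
  defines "L \<equiv> \<lambda>e. e * a + cnj (e * b)"
  assumes K: "1 \<le> K" and qr: "onorm L \<le> K * min_stretch L"
  shows "4 * (norm a * norm b) \<le> (K\<^sup>2 - 1) * (norm (a + b))\<^sup>2"
proof -
  obtain e where e: "norm e = 1" "norm (L e) = norm a + norm b" "norm (L (\<i> * e)) = \<bar>norm a - norm b\<bar>"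
    using harmonic_extremal_directions[of a b] unfolding L_def by metis
  have "bounded_linear L"
    unfolding L_def
    by (intro bounded_linear_add bounded_linear_mult_left bounded_linear_compose[OF bounded_linear_cnj])
  then have "norm a + norm b \<le> onorm L" using onorm[of L e] e by simp
  also have "\<dots> \<le> K * min_stretch L" by (rule qr)
  also have "\<dots> \<le> K * \<bar>norm a - norm b\<bar>"
    using K min_stretch_le[of "\<i> * e" L] e by (intro mult_left_mono) (auto simp: norm_mult)
  finally have "(norm a + norm b)\<^sup>2 \<le> (K * \<bar>norm a - norm b\<bar>)\<^sup>2" by (intro power_mono) auto
  then have "4 * (norm a * norm b) \<le> (K\<^sup>2 - 1) * (norm a - norm b)\<^sup>2"
    by (simp add: power_mult_distrib power2_eq_square algebra_simps)
  also have "\<dots> \<le> (K\<^sup>2 - 1) * (norm (a + b))\<^sup>2"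
  proof (rule mult_left_mono)
    have "\<bar>norm a - norm b\<bar> \<le> norm (a + b)" using norm_triangle_ineq3[of a "- b"] by simp
    then show "(norm a - norm b)\<^sup>2 \<le> (norm (a + b))\<^sup>2" by (metis abs_ge_zero power2_abs power_mono)
    show "0 \<le> K\<^sup>2 - 1" using K by simp
  qed
  finally show ?thesis .
qed

text \<open>The subset of S on which u > v is open and null, hence empty.\<close>

lemma AE_lborel_le_imp_le:
  fixes u v :: "'a::euclidean_space \<Rightarrow> real"
  assumes S: "open S" and cont: "continuous_on S u" "continuous_on S v"
    and ae: "AE x in lborel. x \<in> S \<longrightarrow> u x \<le> v x" and x: "x \<in> S"
  shows "u x \<le> v x"
proof -
  define U where "U = S \<inter> (\<lambda>x. u x - v x) -` {0<..}"
  have U: "open U"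
    unfolding U_def by (intro continuous_open_preimage continuous_intros cont S)
  have "AE x in lborel. x \<notin> U"
    using ae by eventually_elim (auto simp: U_def)
  then have "U \<in> null_sets lborel" using U by (subst AE_iff_null_sets) auto
  then have "negligible U" by (simp add: negligible_iff_null_sets null_sets_completionI)
  then have "U = {}" using open_not_negligible U by blast
  then show ?thesis using x by (auto simp: U_def)
qed

text \<open>The condition is given almost everywhere, and continuity of both sides extends the
  inequality to every point of the disk. The differential of \<open>f\<close> is the map
  \<open>L\<close> of \<open>harmonic_dilatation_bound\<close> with a = g' and b = h'.\<close>

lemma quasiregular_harmonic_dilatation:
  fixes f g h :: "complex \<Rightarrow> complex"
  assumes K: "1 \<le> K" and qr: "quasiregular_disk K f"
    and g: "g holomorphic_on ball 0 1" and h: "h holomorphic_on ball 0 1"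
    and f: "\<And>z. z \<in> ball 0 1 \<Longrightarrow> f z = g z + cnj (h z)" and z: "z \<in> ball 0 1"
  shows "4 * (norm (deriv g z) * norm (deriv h z)) \<le> (K\<^sup>2 - 1) * (norm (deriv g z + deriv h z))\<^sup>2"
proof (rule AE_lborel_le_imp_le[OF open_ball _ _ _ z])
  have c: "continuous_on (ball 0 1) (deriv g)" "continuous_on (ball 0 1) (deriv h)"
    by (auto intro!: holomorphic_on_imp_continuous_on holomorphic_deriv g h)
  show "continuous_on (ball 0 1) (\<lambda>z. 4 * (norm (deriv g z) * norm (deriv h z)))"
    "continuous_on (ball 0 1) (\<lambda>z. (K\<^sup>2 - 1) * (norm (deriv g z + deriv h z))\<^sup>2)"
    by (intro continuous_intros c)+
  have D: "frechet_derivative f (at w) = (\<lambda>e. e * deriv g w + cnj (e * deriv h w))" if w: "w \<in> ball 0 1" for w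
  proof -
    have "(g has_derivative (*) (deriv g w)) (at w)" "(h has_derivative (*) (deriv h w)) (at w)"
      using holomorphic_derivI[OF g _ w] holomorphic_derivI[OF h _ w]
      by (auto simp: has_field_derivative_def)
    then have "((\<lambda>z. g z + cnj (h z)) has_derivative (\<lambda>e. deriv g w * e + cnj (deriv h w * e))) (at w)"
      by (intro derivative_intros)
    then have "(f has_derivative (\<lambda>e. deriv g w * e + cnj (deriv h w * e))) (at w)"
      by (rule has_derivative_transform_within_open[OF _ open_ball w]) (simp add: f)
    then show ?thesis by (simp add: frechet_derivative_at[symmetric] mult.commute)
  qed
  have "AE w in lborel. w \<in> ball 0 1 \<longrightarrow>
      onorm (frechet_derivative f (at w)) \<le> K * min_stretch (frechet_derivative f (at w))"
    using qr unfolding quasiregular_disk_def by (auto elim: eventually_mono)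
  then show "AE w in lborel. w \<in> ball 0 1 \<longrightarrow>
      4 * (norm (deriv g w) * norm (deriv h w)) \<le> (K\<^sup>2 - 1) * (norm (deriv g w + deriv h w))\<^sup>2"
    by eventually_elim (use D harmonic_dilatation_bound[OF K] in auto)
qed

section \<open>Norm estimates\<close>

lemma circ_mean_nonneg: "0 \<le> circ_mean p u r"
proof (cases "(\<lambda>t. norm (u (of_real r * exp (\<i> * of_real t))) powr p) integrable_on {0..2*pi}")
  case True
  then show ?thesis unfolding circ_mean_def by (intro divide_nonneg_pos integral_nonneg) auto
next
  \<comment> \<open>The integral of a non-integrable function is 0 by convention.\<close>
  case False
  then show ?thesis unfolding circ_mean_def by (subst not_integrable_integral) auto
qed

lemma hp_norm_le_of_circ_mean_le:
  fixes u :: "complex \<Rightarrow> 'a::real_normed_vector" and v :: "complex \<Rightarrow> 'b::real_normed_vector"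
  assumes p: "0 < p" and D: "0 \<le> D" and v: "in_hp p v"
    and le: "\<And>r. 0 < r \<Longrightarrow> r < 1 \<Longrightarrow> circ_mean p u r \<le> D * circ_mean p v r"
  shows "in_hp p u" "hp_norm p u \<le> D powr (1/p) * hp_norm p v"
proof -
  have *: "circ_mean p u r powr (1/p) \<le> D powr (1/p) * hp_norm p v" if r: "r \<in> {0<..<1}" for r
  proof -
    have "circ_mean p u r powr (1/p) \<le> (D * circ_mean p v r) powr (1/p)"
      using p r le circ_mean_nonneg by (intro powr_mono2) auto
    also have "\<dots> = D powr (1/p) * circ_mean p v r powr (1/p)"
      using D circ_mean_nonneg by (simp add: powr_mult)
    \<comment> \<open>A real supremum dominates its family only when that family is bounded above;
      this is where \<open>in_hp p v\<close> enters.\<close>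
    also have "\<dots> \<le> D powr (1/p) * hp_norm p v"
      using v r unfolding hp_norm_def in_hp_def by (intro mult_left_mono cSUP_upper) auto
    finally show ?thesis .
  qed
  then show "in_hp p u" unfolding in_hp_def by (rule bdd_aboveI2)
  show "hp_norm p u \<le> D powr (1/p) * hp_norm p v"
    unfolding hp_norm_def[of p u] using * by (intro cSUP_least) auto
qed

text \<open>Integrate the pointwise bound. With P and I the integrals of Re(f^p) and |Re f|^p, the
  mean value inequality gives P + \<kappa> I >= 0, so -\<beta> P is at most \<beta> \<kappa>
  I.\<close>

lemma circ_mean_le_Re:
  fixes f g h :: "complex \<Rightarrow> complex" and N :: "complex \<Rightarrow> 'b::real_normed_vector" and p \<kappa> \<alpha> \<beta> r :: real
  assumes p: "1 < p" "p \<le> 2" and \<kappa>: "0 \<le> \<kappa>" and r: "0 < r" "r < 1"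
    and g: "g holomorphic_on ball 0 1" and h: "h holomorphic_on ball 0 1"
    and f: "f = (\<lambda>z. g z + cnj (h z))"
    and avoid: "\<And>z. z \<in> ball 0 1 \<Longrightarrow> 0 \<le> Re (f z) \<or> Im (f z) \<noteq> 0"
    and dil: "\<And>z. z \<in> ball 0 1 \<Longrightarrow>
      4 * (norm (deriv g z) * norm (deriv h z)) \<le> \<kappa> * (norm (deriv g z + deriv h z))\<^sup>2"
    and center: "0 \<le> Re (f 0 powr of_real p)"
    and \<beta>: "0 \<le> \<beta>" and N: "continuous_on UNIV N"
    and pointwise: "\<And>w. norm (N w) powr p \<le> \<alpha> * \<bar>Re w\<bar> powr p - \<beta> * Re (w powr of_real p)"
  shows "circ_mean p (\<lambda>z. N (f z)) r \<le> (\<alpha> + \<beta> * \<kappa>) * circ_mean p (\<lambda>z. Re (f z)) r"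
proof -
  define w where "w = (\<lambda>t. f (of_real r * exp (\<i> * of_real t)))"
  have cw: "continuous_on {0..2*pi} w"
    unfolding w_def f
    by (intro continuous_intros continuous_on_compose2[OF holomorphic_on_imp_continuous_on[OF g]]
        continuous_on_compose2[OF holomorphic_on_imp_continuous_on[OF h]])
      (auto simp: norm_mult abs_of_pos r)
  have w: "0 \<le> Re (w t) \<or> Im (w t) \<noteq> 0" for t
    unfolding w_def by (rule avoid) (simp add: norm_mult r abs_of_pos)
  have iP: "(\<lambda>t. Re (w t powr of_real p)) integrable_on {0..2*pi}"
    using w p by (intro integrable_continuous_real continuous_on_Re continuous_on_powr_complex cw) auto
  have iR: "(\<lambda>t. \<bar>Re (w t)\<bar> powr p) integrable_on {0..2*pi}"
    using p by (intro integrable_continuous_real continuous_on_powr' continuous_on_rabs continuous_on_Re cw) auto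
  have iN: "(\<lambda>t. norm (N (w t)) powr p) integrable_on {0..2*pi}"
    using p by (intro integrable_continuous_real continuous_on_powr' continuous_on_norm
        continuous_on_compose2[OF N cw]) auto
  define P where "P = integral {0..2*pi} (\<lambda>t. Re (w t powr of_real p))"
  define I where "I = integral {0..2*pi} (\<lambda>t. \<bar>Re (w t)\<bar> powr p)"
  have hP: "((\<lambda>t. Re (w t powr of_real p)) has_integral P) {0..2*pi}"
    unfolding P_def using iP by (rule integrable_integral)
  have hI: "((\<lambda>t. \<bar>Re (w t)\<bar> powr p) has_integral I) {0..2*pi}"
    unfolding I_def using iR by (rule integrable_integral)
  note hD = has_integral_diff[OF has_integral_mult_right[OF hI, of \<alpha>] has_integral_mult_right[OF hP, of \<beta>]]
  have "0 \<le> 2 * pi * Re (f 0 powr of_real p)" using center by simp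
  also have "\<dots> \<le> integral {0..2*pi} (\<lambda>t. Re (w t powr of_real p) + \<kappa> * \<bar>Re (w t)\<bar> powr p)"
    unfolding w_def by (rule circle_mean_Re_powr_ge[OF p \<kappa> r g h f avoid dil])
  also have "\<dots> = P + \<kappa> * I"
    by (rule integral_unique[OF has_integral_add[OF hP has_integral_mult_right[OF hI]]])
  finally have "0 \<le> \<beta> * (P + \<kappa> * I)" using \<beta> by simp
  moreover have "integral {0..2*pi} (\<lambda>t. norm (N (w t)) powr p)
      \<le> integral {0..2*pi} (\<lambda>t. \<alpha> * \<bar>Re (w t)\<bar> powr p - \<beta> * Re (w t powr of_real p))"
    by (rule integral_le[OF iN has_integral_integrable[OF hD] pointwise])
  moreover have "\<dots> = \<alpha> * I - \<beta> * P"
    by (rule integral_unique[OF hD])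
  ultimately have "integral {0..2*pi} (\<lambda>t. norm (N (w t)) powr p) \<le> (\<alpha> + \<beta> * \<kappa>) * I"
    by (simp add: algebra_simps)
  then have "integral {0..2*pi} (\<lambda>t. norm (N (w t)) powr p) / (2*pi) \<le> (\<alpha> + \<beta> * \<kappa>) * I / (2*pi)"
    by (rule divide_right_mono) simp
  then show ?thesis
    unfolding circ_mean_def I_def w_def real_norm_def by (simp only: times_divide_eq_right)
qed

theorem theorem2p2:
  fixes f :: "complex \<Rightarrow> complex" and p K :: real
  assumes "1 < p" "p \<le> 2" "1 \<le> K"
    and "harmonic_disk f" "quasiregular_disk K f"
    and "Arg (f 0) \<in> {-pi/(2*p)<..<pi/(2*p)}"
    and "in_hp p (\<lambda>z. Re (f z))"
    and "\<forall>z\<in>ball 0 1. f z \<notin> complex_of_real ` {..<0}"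
  shows "in_hp p f
    \<and> hp_norm p (\<lambda>z. Im (f z)) \<le> cKp K p * hp_norm p (\<lambda>z. Re (f z))
    \<and> hp_norm p f \<le> dKp K p * hp_norm p (\<lambda>z. Re (f z))"
proof -
  obtain g h where g: "g holomorphic_on ball 0 1" and h: "h holomorphic_on ball 0 1"
    and f: "\<And>z. z \<in> ball 0 1 \<Longrightarrow> f z = g z + cnj (h z)"
    using assms(4) unfolding harmonic_disk_def by blast
  \<comment> \<open>\<open>F\<close> is given by the formula everywhere, as the integral lemmas
    require, while \<open>f\<close> agrees with it only on the disk.\<close>
  define F where "F = (\<lambda>z. g z + cnj (h z))"
  define \<theta> where "\<theta> = pi/(2*p)"
  define \<kappa> where "\<kappa> = K\<^sup>2 - 1"
  note th = half_angle_facts[OF assms(1,2) \<theta>_def]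
  have \<kappa>: "0 \<le> \<kappa>" using assms(3) by (simp add: \<kappa>_def)
  have Ff: "F z = f z" if "z \<in> ball 0 1" for z using f[OF that] by (simp add: F_def)
  have avoid: "0 \<le> Re (F z) \<or> Im (F z) \<noteq> 0" if "z \<in> ball 0 1" for z
  proof (rule ccontr)
    assume "\<not> ?thesis"
    then have "F z = of_real (Re (F z))" "Re (F z) \<in> {..<0}" by (auto simp: complex_eq_iff)
    then show False using assms(8) that Ff by (metis image_eqI)
  qed
  have center: "0 \<le> Re (F 0 powr of_real p)"
  proof -
    \<comment> \<open>The sector condition on f(0) is what places f(0)^p in the closed right
      half-plane.\<close>
    have "\<bar>p * Arg (F 0)\<bar> < pi/2" using assms(1,6) Ff[of 0] by (auto simp: abs_less_iff field_simps)
    then have "0 \<le> cos (p * Arg (F 0))" by (intro cos_ge_zero) auto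
    then show ?thesis by (simp add: Re_powr_real)
  qed
  \<comment> \<open>The codomain of \<open>N\<close> is left open, so that this applies to
    \<open>Im\<close> and to the identity alike.\<close>
  have mean: "circ_mean p (\<lambda>z. N (f z)) r \<le> (\<alpha> + \<beta> * \<kappa>) * circ_mean p (\<lambda>z. Re (f z)) r"
    if "0 \<le> \<beta>" "continuous_on UNIV N" "0 < r" "r < 1"
      "\<And>w. norm (N w) powr p \<le> \<alpha> * \<bar>Re w\<bar> powr p - \<beta> * Re (w powr of_real p)"
    for N :: "complex \<Rightarrow> 'b::real_normed_vector" and \<alpha> \<beta> r
  proof -
    have "circ_mean p (\<lambda>z. N (F z)) r \<le> (\<alpha> + \<beta> * \<kappa>) * circ_mean p (\<lambda>z. Re (F z)) r"
      by (rule circ_mean_le_Re[OF assms(1,2) \<kappa> that(3,4) g h F_def avoid _ center that(1,2,5)])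
        (auto simp: \<kappa>_def intro!: quasiregular_harmonic_dilatation[OF assms(3,5) g h f])
    moreover have "F (of_real r * exp (\<i> * of_real t)) = f (of_real r * exp (\<i> * of_real t))" for t
      using that by (intro Ff) (simp add: norm_mult abs_of_pos)
    ultimately show ?thesis by (simp add: circ_mean_def)
  qed
  have "circ_mean p (\<lambda>z. Im (f z)) r \<le> (tan \<theta> powr p + sin \<theta> powr (p-1) / cos \<theta> * \<kappa>) * circ_mean p (\<lambda>z. Re (f z)) r"
    if "0 < r" "r < 1" for r
    using th that abs_Im_powr_le[OF assms(1,2) \<theta>_def] by (intro mean) (auto intro!: continuous_intros)
  from hp_norm_le_of_circ_mean_le(2)[OF _ _ assms(7) this]
  have "hp_norm p (\<lambda>z. Im (f z))
      \<le> (tan \<theta> powr p + sin \<theta> powr (p-1) / cos \<theta> * \<kappa>) powr (1/p) * hp_norm p (\<lambda>z. Re (f z))"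
    using assms(1) th \<kappa> by simp
  \<comment> \<open>Dividing by cot \<theta> multiplies by tan \<theta>, so the first summand of
    \<open>cKp\<close> is tan^p \<theta>.\<close>
  moreover have "cKp K p = (tan \<theta> powr p + sin \<theta> powr (p-1) / cos \<theta> * \<kappa>) powr (1/p)"
  proof -
    have t: "0 < tan \<theta>" using th by (simp add: tan_def)
    have "tan \<theta> powr (p-1) / cot \<theta> = tan \<theta> * tan \<theta> powr (p-1)"
      using th by (simp add: tan_def cot_def)
    also have "\<dots> = tan \<theta> powr p" using powr_mult_base[of "tan \<theta>" "p-1"] t by simp
    finally show ?thesis unfolding cKp_def \<theta>_def[symmetric] by (simp add: \<kappa>_def mult.commute)
  qed
  moreover have "in_hp p f" "hp_norm p f
      \<le> (cos \<theta> powr (-p) + tan \<theta> * \<kappa>) powr (1/p) * hp_norm p (\<lambda>z. Re (f z))"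
  proof -
    have t: "0 < tan \<theta>" using th by (simp add: tan_def)
    have D: "0 \<le> cos \<theta> powr (-p) + tan \<theta> * \<kappa>" using t \<kappa> by simp
    have "circ_mean p f r \<le> (cos \<theta> powr (-p) + tan \<theta> * \<kappa>) * circ_mean p (\<lambda>z. Re (f z)) r"
      if "0 < r" "r < 1" for r
      by (rule mean[OF less_imp_le[OF t] continuous_on_id that norm_powr_le[OF assms(1,2) \<theta>_def]])
    note hp_norm_le_of_circ_mean_le[OF _ D assms(7) this]
    then show "in_hp p f" "hp_norm p f
      \<le> (cos \<theta> powr (-p) + tan \<theta> * \<kappa>) powr (1/p) * hp_norm p (\<lambda>z. Re (f z))"
      using assms(1) by simp_all
  qed
  moreover have "dKp K p = (cos \<theta> powr (-p) + tan \<theta> * \<kappa>) powr (1/p)"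
    unfolding dKp_def \<theta>_def[symmetric] by (simp add: \<kappa>_def mult.commute)
  ultimately show ?thesis by simp
qed

end
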